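(* Assume the Gaussian sequence model and that the prior $\pi$ satisfies Conditions 1, 2 and 3($C$) with $p=p_n$, where $p_n/n\to0$. Fix $\alpha\in(0,1)$ and let $\xi_i=\mathbf 1\{m_{X_i}>\alpha\}$, $\Xi=(\xi_1,\dots,\xi_n)$. There is a constant $C_1$ (depending only on $\alpha,u_*,u_0,R,b,b',C'$) such that for every sequence $v_n\to\infty$, with $\rho_n=C_1+\sqrt{2K(u_0+1)\log(n/p_n)}+v_n$, and every $\lambda\in(0,1)$, $$\sup_{\theta:\ |S_0|=p_n,\ \min_{i\in S_0}|\theta_i|\ge\rho_n}R_n^{sup}(\Xi)\le\left(\frac{1}{1+\frac{\lambda\alpha c}{8C\sqrt\pi}}+\Phi(-v_n)\right)(1+o(1)).$$
   Context: Model: $X_i=\theta_i+\epsilon_i$, $i=1,\dots,n$, $\epsilon_i$ i.i.d. $\mathcal N(0,1)$; $\mathbb E_\theta$ denotes expectation under this model with parameter $\theta$. Prior: independently, $\theta_i\mid\sigma_i^2\sim\mathcal N(0,\sigma_i^2)$, $\sigma_i^2\sim\pi$, $\pi$ a density on $(0,\infty)$; $$m_x=\frac{\int_0^\infty u(1+u)^{-3/2}e^{\frac{x^2}{2}\frac{u}{1+u}}\pi(u)\,du}{\int_0^\infty (1+u)^{-1/2}e^{\frac{x^2}{2}\frac{u}{1+u}}\pi(u)\,du}.$$ Notation: $\tau_n(p)=p/n$, $\nu_n(p)=\sqrt{\log(n/p)}$, $s_n=\tau_n(p)\nu_n(p)^2$; $\Phi$ standard normal cdf. Uniformly regularly varying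 at infinity: there exist $R,u_0>0$ with $1/R\le L(au)/L(u)\le R$ for all $a\in[1,2]$, $u\ge u_0$. Condition 1: for some $b\ge0$, $\pi(u)=L_n(u)e^{-bu}$, $L_n$ uniformly regularly varying with $R,u_0$ independent of $n$; and constants $C',b'>0$, $K\ge0$, $u_*\ge1$ with $C'\pi(u)\ge\tau_n(p)^Ke^{-b'u}$ for $u\ge u_*$. Condition 2: $\int_0^1\pi(u)du\ge c>0$. Condition 3($C$): $\int_{s_n}^\infty\big(u\wedge\frac{\nu_n(p)^3}{\sqrt u}\big)\pi(u)du+\nu_n(p)\int_1^{\nu_n(p)^2}\frac{\pi(u)}{\sqrt u}du\le Cs_n$. $S_0=\{i:\theta_i\ne0\}$. $FDR_n(\Xi)=\mathbb E_\theta\Big(\frac{\sum_{i\in S_0^c}\xi_i}{(\sum_{i=1}^n\xi_i)\vee1}\Big)$, $FNR_n(\Xi)=\mathbb E_\theta\Big(\frac{\sum_{i\in S_0}(1-\xi_i)}{p_n}\Big)$, $R_n^{sup}(\Xi)=FDR_n(\Xi)+FNR_n(\Xi)$. *)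

theory Defs
  imports "HOL-Probability.Probability"
begin

definition gauss_model :: "nat \<Rightarrow> (nat \<Rightarrow> real) \<Rightarrow> (nat \<Rightarrow> real) measure" where
  "gauss_model n \<theta> = PiM {..<n} (\<lambda>i. density lborel (normal_density (\<theta> i) 1))"

definition Phi :: "real \<Rightarrow> real" where
  "Phi x = (LINT t:{..x}|lborel. std_normal_density t)"

definition tau :: "nat \<Rightarrow> nat \<Rightarrow> real" where
  "tau n p = real p / real n"

definition nu :: "nat \<Rightarrow> nat \<Rightarrow> real" where
  "nu n p = sqrt (ln (real n / real p))"

definition s_n :: "nat \<Rightarrow> nat \<Rightarrow> real" where
  "s_n n p = tau n p * (nu n p)^2"

definition mx :: "(real \<Rightarrow> real) \<Rightarrow> real \<Rightarrow> real" where
  "mx f x =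
     (LINT u:{0<..}|lborel. u * (1 + u) powr (-3/2) * exp (x^2 / 2 * (u / (1 + u))) * f u)
   / (LINT u:{0<..}|lborel. (1 + u) powr (-1/2) * exp (x^2 / 2 * (u / (1 + u))) * f u)"

definition is_prior_density :: "(real \<Rightarrow> real) \<Rightarrow> bool" where
  "is_prior_density f \<longleftrightarrow> (\<forall>u>0. 0 \<le> f u) \<and> set_integrable lborel {0<..} f
      \<and> (LINT u:{0<..}|lborel. f u) = 1"

definition cond1 :: "real \<Rightarrow> real \<Rightarrow> real \<Rightarrow> real \<Rightarrow> real \<Rightarrow> real \<Rightarrow> real
     \<Rightarrow> (real \<Rightarrow> real) \<Rightarrow> nat \<Rightarrow> nat \<Rightarrow> bool" where
  "cond1 b R u0 C' b' K ustar f n p \<longleftrightarrow>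
     (\<exists>L :: real \<Rightarrow> real.
        (\<forall>u>0. f u = L u * exp (- b * u)) \<and>
        (\<forall>a\<in>{1..2}. \<forall>u\<ge>u0. 1 / R \<le> L (a * u) / L u \<and> L (a * u) / L u \<le> R)) \<and>
     (\<forall>u\<ge>ustar. C' * f u \<ge> tau n p powr K * exp (- b' * u))"

definition cond2 :: "real \<Rightarrow> (real \<Rightarrow> real) \<Rightarrow> bool" where
  "cond2 c f \<longleftrightarrow> (LINT u:{0<..1}|lborel. f u) \<ge> c"

definition cond3 :: "real \<Rightarrow> (real \<Rightarrow> real) \<Rightarrow> nat \<Rightarrow> nat \<Rightarrow> bool" where
  "cond3 C f n p \<longleftrightarrow>
     (LINT u:{s_n n p<..}|lborel. min u (nu n p ^ 3 / sqrt u) * f u)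
     + nu n p * (LINT u:{1..(nu n p)^2}|lborel. f u / sqrt u) \<le> C * s_n n p"

definition xi :: "(real \<Rightarrow> real) \<Rightarrow> real \<Rightarrow> real \<Rightarrow> real" where
  "xi f \<alpha> x = (if mx f x > \<alpha> then 1 else 0)"

definition FDR :: "(real \<Rightarrow> real) \<Rightarrow> real \<Rightarrow> nat \<Rightarrow> (nat \<Rightarrow> real) \<Rightarrow> real" where
  "FDR f \<alpha> n \<theta> =
     (\<integral>X. (\<Sum>i\<in>{i. i < n \<and> \<theta> i = 0}. xi f \<alpha> (X i)) / max (\<Sum>i<n. xi f \<alpha> (X i)) 1
       \<partial>gauss_model n \<theta>)"

definition FNR :: "(real \<Rightarrow> real) \<Rightarrow> real \<Rightarrow> nat \<Rightarrow> nat \<Rightarrow> (nat \<Rightarrow> real) \<Rightarrow> real" where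
  "FNR f \<alpha> n p \<theta> =
     (\<integral>X. (\<Sum>i\<in>{i. i < n \<and> \<theta> i \<noteq> 0}. 1 - xi f \<alpha> (X i)) / real p \<partial>gauss_model n \<theta>)"

definition Rsup :: "(real \<Rightarrow> real) \<Rightarrow> real \<Rightarrow> nat \<Rightarrow> nat \<Rightarrow> (nat \<Rightarrow> real) \<Rightarrow> real" where
  "Rsup f \<alpha> n p \<theta> = FDR f \<alpha> n \<theta> + FNR f \<alpha> n p \<theta>"

definition param_set :: "nat \<Rightarrow> nat \<Rightarrow> real \<Rightarrow> (nat \<Rightarrow> real) set" where
  "param_set n p \<rho> = {\<theta>. (\<forall>i\<ge>n. \<theta> i = 0) \<and> card {i. i < n \<and> \<theta> i \<noteq> 0} = p
       \<and> (\<forall>i<n. \<theta> i \<noteq> 0 \<longrightarrow> \<bar>\<theta> i\<bar> \<ge> \<rho>)}"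

end

theory Submission
  imports Defs "HOL-Real_Asymp.Real_Asymp"
begin

text \<open>
  Since \<open>v\<close> diverges, the first summand of the bound is a positive constant \<open>A\<close> and \<open>C1\<close> may be
  absorbed by \<open>v\<close> (so \<open>C1 = 0\<close> works): it suffices that FNR tends to 0 and that FDR is at most \<open>A + o(1)\<close>.

  Type I: splitting the numerator of \<open>mx\<close> at \<open>s_n\<close>, \<open>1\<close> and \<open>nu ^ 2\<close>, Condition 3 bounds it by
  \<open>o(1) + exp (x^2 / 2) * C * tau * nu\<close>, while the denominator is at least \<open>c / sqrt 2\<close>. So a rejection
  forces \<open>exp (x^2 / 2)\<close> to be of order \<open>1 / (tau * nu)\<close>, hence \<open>\<bar>x\<bar> \<ge> nu\<close>, and the Mills ratio bound gives
  a rejection probability of at most \<open>T * tau\<close> with \<open>T = 8 * C * sqrt pi / (\<alpha> * c)\<close>.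

  Type II: \<open>mx f x > \<alpha>\<close> says that \<open>u - \<alpha> / (1 - \<alpha>)\<close> has positive mean under the prior tilted by
  \<open>(1 + u) powr (-3/2) * exp (x^2 / 2 * (u / (1 + u)))\<close>. As \<open>\<bar>x\<bar>\<close> grows, the tilt favours large \<open>u\<close>.
\<close>

section \<open>Gaussian tails\<close>

text \<open>Mills ratio bound: on \<open>{t..}\<close> the factor \<open>x / t\<close> is at least
  1, and \<open>x * std_normal_density x\<close> is minus the derivative of the density, so the
  enlarged integral is computed exactly.\<close>

lemma std_normal_upper_tail:
  assumes t: "0 < t"
  shows "(\<integral>\<^sup>+x. ennreal (std_normal_density x) * indicator {t..} x \<partial>lborel)
    \<le> ennreal (std_normal_density t / t)"
proof -
  have "(\<integral>\<^sup>+x. ennreal (std_normal_density x) * indicator {t..} x \<partial>lborel)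
    \<le> (\<integral>\<^sup>+x. ennreal (x / t * std_normal_density x) * indicator {t..} x \<partial>lborel)"
  proof (intro nn_integral_mono)
    fix x :: real
    have "1 * std_normal_density x \<le> x / t * std_normal_density x" if "t \<le> x"
      using that t by (intro mult_right_mono) auto
    then show "ennreal (std_normal_density x) * indicator {t..} x
      \<le> ennreal (x / t * std_normal_density x) * indicator {t..} x"
      by (auto simp: indicator_def intro!: ennreal_leI)
  qed
  also have "\<dots> = ennreal (0 - (- (std_normal_density t / t)))"
  proof (rule nn_integral_FTC_atLeast[where F = "\<lambda>x. - (std_normal_density x / t)"])
    fix x :: real
    assume x: "t \<le> x"
    show "((\<lambda>x. - (std_normal_density x / t)) has_real_derivative x / t * std_normal_density x) (at x)"
      unfolding std_normal_density_def using t
      by (auto intro!: derivative_eq_intros simp: power2_eq_square field_simps)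
    show "0 \<le> x / t * std_normal_density x"
      using x t by auto
  next
    show "((\<lambda>x. - (std_normal_density x / t)) \<longlongrightarrow> 0) at_top"
      unfolding std_normal_density_def using t by real_asymp
  qed auto
  finally show ?thesis by simp
qed

text \<open>Shifting by \<mu> reduces to the standard density, and reflection makes the left tail
  equal to the right one. The bound serves both null coordinates (\<mu> = 0) and signals.\<close>

lemma normal_tail:
  assumes t: "0 < t"
  shows "measure (density lborel (normal_density \<mu> 1)) {x. t \<le> \<bar>x - \<mu>\<bar>} \<le> 2 * (std_normal_density t / t)"
proof -
  have "emeasure (density lborel (normal_density \<mu> 1)) {x. t \<le> \<bar>x - \<mu>\<bar>}
    = (\<integral>\<^sup>+x. ennreal (normal_density \<mu> 1 x) * indicator {x. t \<le> \<bar>x - \<mu>\<bar>} x \<partial>lborel)"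
    by (subst emeasure_density) auto
  also have "\<dots> = (\<integral>\<^sup>+x. ennreal (std_normal_density x) * indicator {x. t \<le> \<bar>x\<bar>} x \<partial>lborel)"
    by (subst nn_integral_real_affine[where c = 1 and t = \<mu>])
       (auto simp: normal_density_def indicator_def)
  also have "\<dots> \<le> (\<integral>\<^sup>+x. ennreal (std_normal_density x) * indicator {t..} x
      + ennreal (std_normal_density x) * indicator {..-t} x \<partial>lborel)"
    by (intro nn_integral_mono) (auto simp: indicator_def)
  also have "\<dots> = (\<integral>\<^sup>+x. ennreal (std_normal_density x) * indicator {t..} x \<partial>lborel)
      + (\<integral>\<^sup>+x. ennreal (std_normal_density x) * indicator {..-t} x \<partial>lborel)"
    by (subst nn_integral_add) auto
  also have "(\<integral>\<^sup>+x. ennreal (std_normal_density x) * indicator {..-t} x \<partial>lborel)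
      = (\<integral>\<^sup>+x. ennreal (std_normal_density x) * indicator {t..} x \<partial>lborel)"
    by (subst nn_integral_real_affine[where c = "-1" and t = 0])
       (auto simp: std_normal_density_def indicator_def intro!: nn_integral_cong)
  also have "(\<integral>\<^sup>+x. ennreal (std_normal_density x) * indicator {t..} x \<partial>lborel)
      + (\<integral>\<^sup>+x. ennreal (std_normal_density x) * indicator {t..} x \<partial>lborel)
      \<le> ennreal (std_normal_density t / t) + ennreal (std_normal_density t / t)"
    by (intro add_mono std_normal_upper_tail t)
  also have "\<dots> = ennreal (2 * (std_normal_density t / t))"
    using t by (subst ennreal_plus[symmetric]) auto
  finally show ?thesis
    unfolding measure_def using t by (intro enn2real_leI) auto
qed

section \<open>Integrals against the prior\<close>

text \<open>Extension of \<open>f\<close> by zero. A prior density is constrained only on the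
  positive half-line; the extension is nonnegative and integrable on the whole line, so set
  integrals become plain ones.\<close>

definition prior_ext :: "(real \<Rightarrow> real) \<Rightarrow> real \<Rightarrow> real" where
  "prior_ext f u = indicator {0<..} u * f u"

lemma prior_ext_pos: "0 < u \<Longrightarrow> prior_ext f u = f u"
  by (simp add: prior_ext_def)

lemma set_lebesgue_integral_prior_ext:
  assumes "A \<subseteq> {0<..}"
  shows "(LINT u:A|lborel. w u * f u) = (\<integral>u. indicator A u * w u * prior_ext f u \<partial>lborel)"
  unfolding set_lebesgue_integral_def using assms
  by (intro Bochner_Integration.integral_cong) (auto simp: prior_ext_def indicator_def)

lemma prior_ext_facts:
  assumes "is_prior_density f"
  shows prior_ext_nonneg: "0 \<le> prior_ext f u"
    and prior_ext_integrable: "integrable lborel (prior_ext f)"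
    and prior_ext_integral: "(\<integral>u. prior_ext f u \<partial>lborel) = 1"
proof -
  show "0 \<le> prior_ext f u"
    using assms by (auto simp: is_prior_density_def prior_ext_def indicator_def)
  show "integrable lborel (prior_ext f)"
    using assms by (simp add: is_prior_density_def prior_ext_def[abs_def] set_integrable_def)
  show "(\<integral>u. prior_ext f u \<partial>lborel) = 1"
    using assms by (simp add: is_prior_density_def prior_ext_def set_lebesgue_integral_def)
qed

lemma prior_ext_weight_integrable:
  assumes f: "is_prior_density f" and w: "w \<in> borel_measurable borel"
    and bd: "\<And>u. 0 < u \<Longrightarrow> \<bar>w u\<bar> \<le> B"
  shows "integrable lborel (\<lambda>u. w u * prior_ext f u)"
proof (rule Bochner_Integration.integrable_bound)
  show "integrable lborel (\<lambda>u. B * prior_ext f u)"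
    using prior_ext_integrable[OF f] by simp
  show "(\<lambda>u. w u * prior_ext f u) \<in> borel_measurable lborel"
    using w borel_measurable_integrable[OF prior_ext_integrable[OF f]] by simp
  show "AE u in lborel. norm (w u * prior_ext f u) \<le> norm (B * prior_ext f u)"
  proof (intro AE_I2)
    fix u
    show "norm (w u * prior_ext f u) \<le> norm (B * prior_ext f u)"
    proof (cases "0 < u")
      case True
      then have "\<bar>w u\<bar> \<le> \<bar>B\<bar>" using bd[OF True] by linarith
      then show ?thesis by (simp add: abs_mult mult_right_mono)
    qed (simp add: prior_ext_def)
  qed
qed

section \<open>Numerator and denominator of \<open>mx\<close>\<close>

definition mx_num :: "(real \<Rightarrow> real) \<Rightarrow> real \<Rightarrow> real" where
  "mx_num f x = (\<integral>u. u * (1 + u) powr (-3/2) * exp (x\<^sup>2 / 2 * (u / (1 + u))) * prior_ext f u \<partial>lborel)"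

definition mx_den :: "(real \<Rightarrow> real) \<Rightarrow> real \<Rightarrow> real" where
  "mx_den f x = (\<integral>u. (1 + u) powr (-1/2) * exp (x\<^sup>2 / 2 * (u / (1 + u))) * prior_ext f u \<partial>lborel)"

lemma mx_eq: "mx f x = mx_num f x / mx_den f x"
  unfolding mx_def mx_num_def mx_den_def set_lebesgue_integral_def
  by (intro arg_cong2[where f = "(/)"] Bochner_Integration.integral_cong)
     (auto simp: prior_ext_def indicator_def)

lemma mx_measurable:
  assumes f: "is_prior_density f"
  shows "mx f \<in> borel_measurable borel"
proof -
  have [measurable]: "prior_ext f \<in> borel_measurable borel"
    using borel_measurable_integrable[OF prior_ext_integrable[OF f]] by simp
  have "mx f = (\<lambda>x. mx_num f x / mx_den f x)"
    by (simp add: mx_eq fun_eq_iff)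
  then show ?thesis
    unfolding mx_num_def mx_den_def by simp
qed

lemma shrinkage_exponent_le: "0 < u \<Longrightarrow> x\<^sup>2 / 2 * (u / (1 + u)) \<le> x\<^sup>2 / (2 :: real)"
  using mult_left_le[of "u / (1 + u)" "x\<^sup>2 / 2"] by (simp add: field_simps)

lemma powr_le_one_of_nonpos: "0 < u \<Longrightarrow> a \<le> 0 \<Longrightarrow> (1 + u) powr a \<le> (1 :: real)"
  using powr_mono[of a 0 "1 + u"] by simp

text \<open>Comes from \<open>u \<le> 1 + u\<close>. It puts the weight of the numerator of
  \<open>mx\<close> below that of the denominator, hence also below
  \<open>1 / sqrt u\<close>.\<close>

lemma mul_powr_three_halves: "0 < u \<Longrightarrow> u * (1 + u) powr (-3/2) \<le> (1 + u) powr (-1/2 :: real)"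
proof -
  assume u: "0 < u"
  have "u * (1 + u) powr (-3/2) \<le> (1 + u) powr 1 * (1 + u) powr (-3/2)"
    using u by (intro mult_right_mono) auto
  also have "\<dots> = (1 + u) powr (-1/2)"
    by (subst powr_add[symmetric]) simp
  finally show ?thesis .
qed

lemma mx_integrable:
  assumes f: "is_prior_density f"
  shows mx_num_integrable:
      "integrable lborel (\<lambda>u. u * (1 + u) powr (-3/2) * exp (x\<^sup>2 / 2 * (u / (1 + u))) * prior_ext f u)"
    and mx_den_integrable:
      "integrable lborel (\<lambda>u. (1 + u) powr (-1/2) * exp (x\<^sup>2 / 2 * (u / (1 + u))) * prior_ext f u)"
proof -
  have den: "(1 + u) powr (-1/2) \<le> 1" if "0 < u" for u :: real
    using powr_le_one_of_nonpos[OF that, of "-1/2"] by simp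
  have num: "u * (1 + u) powr (-3/2) \<le> 1" if "0 < u" for u :: real
    using mul_powr_three_halves[OF that] den[OF that] by linarith
  have e: "exp (x\<^sup>2 / 2 * (u / (1 + u))) \<le> exp (x\<^sup>2 / 2)" if "0 < u" for u
    using shrinkage_exponent_le[OF that] by simp
  show "integrable lborel (\<lambda>u. u * (1 + u) powr (-3/2) * exp (x\<^sup>2 / 2 * (u / (1 + u))) * prior_ext f u)"
  proof (rule prior_ext_weight_integrable[OF f, where B = "1 * exp (x\<^sup>2 / 2)"])
    fix u :: real assume u: "0 < u"
    show "\<bar>u * (1 + u) powr (-3/2) * exp (x\<^sup>2 / 2 * (u / (1 + u)))\<bar> \<le> 1 * exp (x\<^sup>2 / 2)"
      unfolding abs_mult abs_exp_cancel using u num[OF u] e[OF u] by (intro mult_mono) auto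
  qed simp
  show "integrable lborel (\<lambda>u. (1 + u) powr (-1/2) * exp (x\<^sup>2 / 2 * (u / (1 + u))) * prior_ext f u)"
  proof (rule prior_ext_weight_integrable[OF f, where B = "1 * exp (x\<^sup>2 / 2)"])
    fix u :: real assume u: "0 < u"
    show "\<bar>(1 + u) powr (-1/2) * exp (x\<^sup>2 / 2 * (u / (1 + u)))\<bar> \<le> 1 * exp (x\<^sup>2 / 2)"
      unfolding abs_mult abs_exp_cancel using u den[OF u] e[OF u] by (intro mult_mono) auto
  qed simp
qed

text \<open>Only the mass on \<open>{0<..1}\<close>, controlled by Condition 2, is kept: there the
  power is at least \<open>1 / sqrt 2\<close> and the exponential at least 1, whatever
  \<open>x\<close> is.\<close>

lemma mx_den_ge:
  assumes f: "is_prior_density f" and c: "cond2 c f"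
  shows "c / sqrt 2 \<le> mx_den f x"
proof -
  have "(LINT u:{0<..1}|lborel. f u) = (LINT u:{0<..1}|lborel. 1 * f u)" by simp
  also have "\<dots> = (\<integral>u. indicator {0<..1} u * 1 * prior_ext f u \<partial>lborel)"
    by (rule set_lebesgue_integral_prior_ext) auto
  finally have "c / sqrt 2 \<le> (\<integral>u. indicator {0<..1} u * prior_ext f u \<partial>lborel) / sqrt 2"
    using c by (auto simp: cond2_def intro!: divide_right_mono)
  also have "\<dots> = (\<integral>u. indicator {0<..1} u / sqrt 2 * prior_ext f u \<partial>lborel)"
    by simp
  also have "\<dots> \<le> mx_den f x"
    unfolding mx_den_def
  proof (intro integral_mono mx_den_integrable[OF f])
    show "integrable lborel (\<lambda>u. indicator {0<..1} u / sqrt 2 * prior_ext f u)"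
      by (rule prior_ext_weight_integrable[OF f, where B = 1]) (auto simp: indicator_def)
    fix u :: real
    show "indicator {0<..1} u / sqrt 2 * prior_ext f u
      \<le> (1 + u) powr (-1/2) * exp (x\<^sup>2 / 2 * (u / (1 + u))) * prior_ext f u"
    proof (cases "u \<in> {0<..1}")
      case True
      have "1 / sqrt 2 = 2 powr (-1/2 :: real)"
        using powr_minus[of "2::real" "1/2"] powr_half_sqrt[of 2] by (simp add: inverse_eq_divide)
      also have "\<dots> \<le> (1 + u) powr (-1/2)"
        using True by (intro powr_mono2') auto
      finally have "1 / sqrt 2 * 1 \<le> (1 + u) powr (-1/2) * exp (x\<^sup>2 / 2 * (u / (1 + u)))"
        using True by (intro mult_mono) auto
      then show ?thesis
        using True by (intro mult_right_mono prior_ext_nonneg[OF f]) auto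
    qed (auto intro!: mult_nonneg_nonneg prior_ext_nonneg[OF f])
  qed
  finally show ?thesis .
qed

section \<open>Type I error\<close>

text \<open>Split at \<open>s\<close>, 1 and \<open>\<nu>\<^sup>2\<close>. The constant term covers
  \<open>u \<le> s\<close>, the two coefficients of the minimum cover \<open>s < u < 1\<close> and
  \<open>u > \<nu>\<^sup>2\<close>, and the last term covers the middle range. The weights are those
  that Condition 3 integrates.\<close>

lemma mx_num_weight_le:
  fixes \<nu> s x u :: real
  assumes \<nu>: "1 \<le> \<nu>" and s: "0 < s" "s \<le> 1" and x: "x\<^sup>2 \<le> 2 * \<nu>\<^sup>2" and u: "0 < u"
  shows "u * (1 + u) powr (-3/2) * exp (x\<^sup>2 / 2 * (u / (1 + u)))
    \<le> s * exp (s * \<nu>\<^sup>2)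
      + (exp (\<nu>\<^sup>2 / 2) + exp (x\<^sup>2 / 2) / \<nu> ^ 3) * (indicator {s<..} u * min u (\<nu> ^ 3 / sqrt u))
      + exp (x\<^sup>2 / 2) * (indicator {1..\<nu>\<^sup>2} u / sqrt u)"
    (is "?w \<le> ?A + ?B * ?I + ?D")
proof -
  have A: "0 \<le> ?A" and B: "0 \<le> ?B" and I: "0 \<le> ?I" and D: "0 \<le> ?D"
    using \<nu> s u by (auto simp: indicator_def)
  have u1: "u * (1 + u) powr (-3/2) \<le> u"
    using powr_le_one_of_nonpos[OF u, of "-3/2"] u mult_left_le[of "(1 + u) powr (-3/2)" u] by simp
  have ex: "exp (x\<^sup>2 / 2 * (u / (1 + u))) \<le> exp (x\<^sup>2 / 2)"
    using shrinkage_exponent_le[OF u] by simp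
  have xu: "x\<^sup>2 / 2 * (u / (1 + u)) \<le> \<nu>\<^sup>2 * (u / (1 + u))"
    by (rule mult_right_mono) (use x u in \<open>simp_all add: divide_simps\<close>)
  consider "u \<le> s" | "s < u" "u < 1" | "1 \<le> u" "u \<le> \<nu>\<^sup>2" | "\<nu>\<^sup>2 < u"
    by linarith
  then show ?thesis
  proof cases
    case 1
    have "u / (1 + u) \<le> s"
      using 1 u s(1) by (simp add: pos_divide_le_eq distrib_left add_increasing2)
    then have "\<nu>\<^sup>2 * (u / (1 + u)) \<le> \<nu>\<^sup>2 * s" by (intro mult_left_mono) auto
    with xu have "x\<^sup>2 / 2 * (u / (1 + u)) \<le> s * \<nu>\<^sup>2" by (simp add: mult.commute)
    moreover have "u * (1 + u) powr (-3/2) \<le> s" using u1 1 by linarith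
    ultimately have "?w \<le> s * exp (s * \<nu>\<^sup>2)"
      using s(1) by (intro mult_mono) simp_all
    then show ?thesis using mult_nonneg_nonneg[OF B I] D by linarith
  next
    case 2
    have "sqrt u \<le> 1" using 2 by simp
    moreover have "1 \<le> \<nu> ^ 3" using \<nu> by simp
    ultimately have "sqrt u \<le> \<nu> ^ 3" by (rule order_trans)
    then have "1 \<le> \<nu> ^ 3 / sqrt u" using u by (simp add: le_divide_eq)
    then have I': "?I = u" using 2 by (simp add: min_def)
    \<comment> \<open>Below 1 the exponent is halved. For \<open>\<nu> = nu n p\<close> the
      resulting \<open>exp (\<nu>\<^sup>2 / 2)\<close> is only \<open>tau n p\<close> to the power
      -1/2, which the factor \<open>s_n n p\<close> from Condition 3 beats.\<close>
    have "u / (1 + u) \<le> 1/2" using 2 u by (simp add: divide_le_eq)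
    then have "\<nu>\<^sup>2 * (u / (1 + u)) \<le> \<nu>\<^sup>2 * (1/2)" by (intro mult_left_mono) auto
    with xu have "x\<^sup>2 / 2 * (u / (1 + u)) \<le> \<nu>\<^sup>2 / 2" by linarith
    then have "?w \<le> u * exp (\<nu>\<^sup>2 / 2)"
      using u1 u by (intro mult_mono) auto
    also have "\<dots> \<le> ?B * ?I"
      unfolding I' using u \<nu> by (simp add: algebra_simps)
    finally show ?thesis using A D by linarith
  next
    case 3
    have "u * (1 + u) powr (-3/2) \<le> (1 + u) powr (-1/2)" by (rule mul_powr_three_halves[OF u])
    also have "\<dots> \<le> u powr (-1/2)" using u by (intro powr_mono2') auto
    also have "\<dots> = 1 / sqrt u"
      using powr_minus[of u "1/2"] powr_half_sqrt[of u] u by (simp add: inverse_eq_divide)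
    finally have "?w \<le> 1 / sqrt u * exp (x\<^sup>2 / 2)"
      using ex u by (intro mult_mono) auto
    also have "\<dots> = ?D" using 3 by simp
    finally show ?thesis using A mult_nonneg_nonneg[OF B I] by linarith
  next
    case 4
    have "1 \<le> \<nu>\<^sup>2" using \<nu> by simp
    then have su: "s < u" using 4 s by linarith
    \<comment> \<open>Beyond \<open>\<nu>\<^sup>2\<close> the minimum is its second argument, so
      \<open>1 / sqrt u\<close> is the Condition 3 weight divided by
      \<open>\<nu> ^ 3\<close>.\<close>
    have "\<nu> \<le> sqrt u" using 4 by (simp add: real_le_rsqrt)
    then have "\<nu> ^ 2 * \<nu> \<le> u * sqrt u"
      using 4 \<nu> u by (intro mult_mono) auto
    then have "\<nu> ^ 3 / sqrt u \<le> u" using u by (simp add: divide_le_eq power3_eq_cube power2_eq_square)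
    then have I': "?I = \<nu> ^ 3 / sqrt u" using su by (simp add: min_def)
    have "u * (1 + u) powr (-3/2) \<le> (1 + u) powr (-1/2)" by (rule mul_powr_three_halves[OF u])
    also have "\<dots> \<le> u powr (-1/2)" using u by (intro powr_mono2') auto
    also have "\<dots> = 1 / sqrt u"
      using powr_minus[of u "1/2"] powr_half_sqrt[of u] u by (simp add: inverse_eq_divide)
    finally have "?w \<le> 1 / sqrt u * exp (x\<^sup>2 / 2)"
      using ex u by (intro mult_mono) auto
    also have "\<dots> = exp (x\<^sup>2 / 2) / \<nu> ^ 3 * ?I"
      unfolding I' using \<nu> by simp
    also have "\<dots> \<le> ?B * ?I"
      using I by (intro mult_right_mono) auto
    finally show ?thesis using A D by linarith
  qed
qed

lemma cond3_weight_nonneg: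
  "0 < s \<Longrightarrow> 0 \<le> \<nu> \<Longrightarrow> 0 \<le> indicator {s<..} u * min u (\<nu> ^ 3 / sqrt (u :: real))"
  by (cases "s < u") auto

text \<open>The Bochner integral of a non-integrable function is 0, so Condition 3 bounds something
  only once both integrands are known to be integrable. The weights are bounded by
  \<open>1 + \<nu> ^ 3\<close> and by 1.\<close>

lemma cond3_integrals:
  fixes \<nu> s :: real
  assumes f: "is_prior_density f" and \<nu>: "1 \<le> \<nu>" and s: "0 < s"
  shows "integrable lborel (\<lambda>u. indicator {s<..} u * min u (\<nu> ^ 3 / sqrt u) * prior_ext f u)"
    and "integrable lborel (\<lambda>u. indicator {1..\<nu>\<^sup>2} u / sqrt u * prior_ext f u)"
    and "(LINT u:{s<..}|lborel. min u (\<nu> ^ 3 / sqrt u) * f u)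
      = (\<integral>u. indicator {s<..} u * min u (\<nu> ^ 3 / sqrt u) * prior_ext f u \<partial>lborel)"
    and "(LINT u:{1..\<nu>\<^sup>2}|lborel. f u / sqrt u)
      = (\<integral>u. indicator {1..\<nu>\<^sup>2} u / sqrt u * prior_ext f u \<partial>lborel)"
proof -
  show "integrable lborel (\<lambda>u. indicator {s<..} u * min u (\<nu> ^ 3 / sqrt u) * prior_ext f u)"
  proof (rule prior_ext_weight_integrable[OF f, where B = "1 + \<nu> ^ 3"])
    fix u :: real assume u: "0 < u"
    have "min u (\<nu> ^ 3 / sqrt u) \<le> 1 + \<nu> ^ 3"
    proof (cases "u \<le> 1")
      case True
      then show ?thesis using \<nu> by (simp add: min_le_iff_disj add_increasing2)
    next
      case False
      then have "\<nu> ^ 3 / sqrt u \<le> \<nu> ^ 3 / 1" using \<nu> by (intro divide_left_mono) auto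
      then show ?thesis by (simp add: min_le_iff_disj)
    qed
    moreover have "0 \<le> min u (\<nu> ^ 3 / sqrt u)" using u \<nu> by simp
    ultimately show "\<bar>indicator {s<..} u * min u (\<nu> ^ 3 / sqrt u)\<bar> \<le> 1 + \<nu> ^ 3"
      using \<nu> by (auto simp: indicator_def)
  qed simp
  show "integrable lborel (\<lambda>u. indicator {1..\<nu>\<^sup>2} u / sqrt u * prior_ext f u)"
    by (rule prior_ext_weight_integrable[OF f, where B = 1]) (auto simp: indicator_def)
  show "(LINT u:{s<..}|lborel. min u (\<nu> ^ 3 / sqrt u) * f u)
      = (\<integral>u. indicator {s<..} u * min u (\<nu> ^ 3 / sqrt u) * prior_ext f u \<partial>lborel)"
    using s by (intro set_lebesgue_integral_prior_ext) auto
  have "(LINT u:{1..\<nu>\<^sup>2}|lborel. f u / sqrt u) = (LINT u:{1..\<nu>\<^sup>2}|lborel. 1 / sqrt u * f u)"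
    by simp
  also have "\<dots> = (\<integral>u. indicator {1..\<nu>\<^sup>2} u * (1 / sqrt u) * prior_ext f u \<partial>lborel)"
    by (intro set_lebesgue_integral_prior_ext) auto
  finally show "(LINT u:{1..\<nu>\<^sup>2}|lborel. f u / sqrt u)
      = (\<integral>u. indicator {1..\<nu>\<^sup>2} u / sqrt u * prior_ext f u \<partial>lborel)"
    by simp
qed

lemma mx_num_le:
  fixes n p :: nat
  defines "\<nu> \<equiv> nu n p" and "s \<equiv> s_n n p"
  assumes f: "is_prior_density f" and c3: "cond3 C f n p"
    and \<nu>: "1 \<le> \<nu>" and s: "0 < s" "s \<le> 1" and x: "x\<^sup>2 \<le> 2 * \<nu>\<^sup>2"
  shows "mx_num f x \<le> s * exp (s * \<nu>\<^sup>2) + exp (\<nu>\<^sup>2 / 2) * (C * s) + exp (x\<^sup>2 / 2) * (C * s / \<nu>)"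
proof -
  note ints = cond3_integrals[OF f \<nu> s(1)]
  let ?i1 = "\<lambda>u. indicator {s<..} u * min u (\<nu> ^ 3 / sqrt u) * prior_ext f u"
  let ?i2 = "\<lambda>u. indicator {1..\<nu>\<^sup>2} u / sqrt u * prior_ext f u"
  let ?B = "exp (\<nu>\<^sup>2 / 2) + exp (x\<^sup>2 / 2) / \<nu> ^ 3"
  define A1 where "A1 = (\<integral>u. ?i1 u \<partial>lborel)"
  define A2 where "A2 = (\<integral>u. ?i2 u \<partial>lborel)"
  have le: "A1 + \<nu> * A2 \<le> C * s"
    using c3 ints(3,4) unfolding cond3_def \<nu>_def s_def A1_def A2_def by simp
  have A1: "0 \<le> A1" unfolding A1_def
    using \<nu> s(1) by (intro integral_nonneg_AE AE_I2 mult_nonneg_nonneg prior_ext_nonneg[OF f]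
      cond3_weight_nonneg) auto
  have A2: "0 \<le> A2" unfolding A2_def
    by (intro integral_nonneg_AE AE_I2 mult_nonneg_nonneg prior_ext_nonneg[OF f])
      (auto simp: indicator_def)
  have "mx_num f x \<le> (\<integral>u. s * exp (s * \<nu>\<^sup>2) * prior_ext f u + ?B * ?i1 u + exp (x\<^sup>2 / 2) * ?i2 u \<partial>lborel)"
    unfolding mx_num_def
  proof (intro integral_mono mx_num_integrable[OF f] Bochner_Integration.integrable_add
      integrable_mult_right ints prior_ext_integrable[OF f])
    fix u :: real
    show "u * (1 + u) powr (-3/2) * exp (x\<^sup>2 / 2 * (u / (1 + u))) * prior_ext f u
      \<le> s * exp (s * \<nu>\<^sup>2) * prior_ext f u + ?B * ?i1 u + exp (x\<^sup>2 / 2) * ?i2 u"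
    proof (cases "0 < u")
      case True
      from mult_right_mono[OF mx_num_weight_le[OF \<nu> s x True] prior_ext_nonneg[OF f]]
      show ?thesis by (simp only: distrib_right mult.assoc)
    qed (simp add: prior_ext_def)
  qed
  also have "\<dots> = s * exp (s * \<nu>\<^sup>2) + ?B * A1 + exp (x\<^sup>2 / 2) * A2"
    unfolding A1_def A2_def using ints(1,2) prior_ext_integrable[OF f] prior_ext_integral[OF f]
    by (simp del: times_divide_eq_left)
  also have "\<dots> = s * exp (s * \<nu>\<^sup>2) + exp (\<nu>\<^sup>2 / 2) * A1 + exp (x\<^sup>2 / 2) * (A1 / \<nu> ^ 3 + A2)"
    by (simp add: algebra_simps)
  also have "\<dots> \<le> s * exp (s * \<nu>\<^sup>2) + exp (\<nu>\<^sup>2 / 2) * (C * s) + exp (x\<^sup>2 / 2) * (C * s / \<nu>)"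
  proof -
    have "0 \<le> \<nu> * A2" using A2 \<nu> by simp
    then have 1: "A1 \<le> C * s" using le by linarith
    \<comment> \<open>The coefficient of \<open>exp (x\<^sup>2 / 2)\<close> is at most the left side
      of Condition 3 divided by \<nu>. The resulting \<open>C * s / \<nu>\<close> equals
      \<open>C * tau n p * \<nu>\<close>, and the Mills ratio later removes the factor
      \<nu>.\<close>
    have "A1 / \<nu> ^ 3 \<le> A1 / \<nu> ^ 1"
      using A1 \<nu> by (intro divide_left_mono power_increasing) auto
    then have "A1 / \<nu> ^ 3 + A2 \<le> (A1 + \<nu> * A2) / \<nu>" using \<nu> by (simp add: field_simps)
    also have "\<dots> \<le> C * s / \<nu>" using le \<nu> by (intro divide_right_mono) auto
    finally have 2: "A1 / \<nu> ^ 3 + A2 \<le> C * s / \<nu>" .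
    show ?thesis
      using mult_left_mono[OF 1 exp_ge_zero[of "\<nu>\<^sup>2 / 2"]] mult_left_mono[OF 2 exp_ge_zero[of "x\<^sup>2 / 2"]] by linarith
  qed
  finally show ?thesis .
qed

lemma cond1_prior_ge:
  assumes "cond1 b R u0 C' b' K ustar f n p" "0 < C'" "ustar \<le> u"
  shows "tau n p powr K * exp (- b' * u) / C' \<le> f u"
proof -
  have "tau n p powr K * exp (- b' * u) \<le> C' * f u"
    using assms unfolding cond1_def by blast
  then show ?thesis using \<open>0 < C'\<close> by (simp add: divide_le_eq mult.commute)
qed

text \<open>The lower bound of Condition 1 gives the prior positive mass beyond
  \<open>ustar\<close>, so the left side of Condition 3 is strictly positive.\<close>

lemma cond3_const_pos:
  assumes f: "is_prior_density f" and c1: "cond1 b R u0 C' b' K ustar f n p"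
    and c3: "cond3 C f n p" and "0 < C'" "1 \<le> ustar" "0 < b'"
    and \<nu>: "1 \<le> nu n p" and s: "0 < s_n n p" "s_n n p \<le> 1" and \<tau>: "0 < tau n p"
  shows "0 < C"
proof -
  let ?\<nu> = "nu n p" and ?s = "s_n n p"
  note ints = cond3_integrals[OF f \<nu> s(1)]
  let ?i1 = "\<lambda>u. indicator {?s<..} u * min u (?\<nu> ^ 3 / sqrt u) * prior_ext f u"
  \<comment> \<open>\<open>d\<close> and \<open>m\<close> bound the prior and the weight from below
    on \<open>{ustar + 1..ustar + 2}\<close>. Starting one unit after \<open>ustar\<close> puts
    every point strictly above \<open>s_n n p\<close>, which is at most 1.\<close>
  define d where "d = tau n p powr K * exp (- b' * (ustar + 2)) / C'"
  define m where "m = min 1 (?\<nu> ^ 3 / sqrt (ustar + 2))"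
  have d: "0 < d" using \<tau> \<open>0 < C'\<close> by (simp add: d_def)
  have m: "0 < m" using \<nu> \<open>1 \<le> ustar\<close> by (simp add: m_def)
  have "0 < m * d" using d m by simp
  also have "m * d = (\<integral>u. indicator {ustar + 1..ustar + 2} u * (m * d) \<partial>lborel)"
    by (subst Bochner_Integration.integral_mult_left) auto
  also have "\<dots> \<le> (\<integral>u. ?i1 u \<partial>lborel)"
  proof (intro integral_mono ints)
    show "integrable lborel (\<lambda>u. indicator {ustar + 1..ustar + 2} u * (m * d))"
      by (intro integrable_mult_left) auto
    fix u :: real
    show "indicator {ustar + 1..ustar + 2} u * (m * d) \<le> ?i1 u"
    proof (cases "u \<in> {ustar + 1..ustar + 2}")
      case True
      then have u: "0 < u" "?s < u" "ustar \<le> u" "u \<le> ustar + 2" "1 \<le> u"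
        using assms by auto
      have "?\<nu> ^ 3 / sqrt (ustar + 2) \<le> ?\<nu> ^ 3 / sqrt u"
        using u \<nu> by (intro divide_left_mono) auto
      then have 1: "m \<le> min u (?\<nu> ^ 3 / sqrt u)"
        using u by (auto simp: m_def intro: min.coboundedI1 min.coboundedI2)
      have "d \<le> tau n p powr K * exp (- b' * u) / C'"
        unfolding d_def using u assms by (intro divide_right_mono mult_left_mono) auto
      also have "\<dots> \<le> prior_ext f u"
        using cond1_prior_ge[OF c1 \<open>0 < C'\<close> u(3)] u by (simp add: prior_ext_pos)
      finally have "d \<le> prior_ext f u" .
      with 1 have "m * d \<le> min u (?\<nu> ^ 3 / sqrt u) * prior_ext f u"
        using m d by (intro mult_mono) auto
      then show ?thesis using True u by simp
    next
      case False
      then show ?thesis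
        using s \<nu> by (auto intro!: mult_nonneg_nonneg[OF cond3_weight_nonneg prior_ext_nonneg[OF f]])
    qed
  qed
  finally have "0 < (\<integral>u. ?i1 u \<partial>lborel)" .
  moreover have "0 \<le> (\<integral>u. indicator {1..?\<nu>\<^sup>2} u / sqrt u * prior_ext f u \<partial>lborel)"
    by (intro integral_nonneg_AE AE_I2 mult_nonneg_nonneg prior_ext_nonneg[OF f])
      (auto simp: indicator_def)
  then have "0 \<le> ?\<nu> * (\<integral>u. indicator {1..?\<nu>\<^sup>2} u / sqrt u * prior_ext f u \<partial>lborel)"
    using \<nu> by simp
  ultimately have "0 < C * ?s"
    using c3 unfolding cond3_def ints(3,4) by linarith
  then show ?thesis using s by (simp add: zero_less_mult_iff)
qed

text \<open>For moderate \<open>x\<close>, a rejection makes the numerator exceed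
  \<open>\<alpha> * c / sqrt 2\<close>, and the terms in \<open>small\<close> use up only half of
  that. For larger \<open>x\<close>, \<open>exp (x\<^sup>2 / 2)\<close> exceeds
  \<open>exp (\<nu>\<^sup>2) = n / p\<close>, which makes the right side at least
  \<open>C * \<nu>\<close>.\<close>

lemma rejection_imp_large:
  fixes n p :: nat
  defines "\<nu> \<equiv> nu n p" and "s \<equiv> s_n n p"
  assumes f: "is_prior_density f" and c2: "cond2 c f" and c3: "cond3 C f n p"
    and pos: "0 < \<alpha>" "0 < c" "0 < C" and np: "1 \<le> p" "p \<le> n"
    and \<nu>: "1 \<le> \<nu>" "\<alpha> * c / (2 * sqrt 2) \<le> C * \<nu>" and s: "0 < s" "s \<le> 1"
    and small: "s * exp (s * \<nu>\<^sup>2) + exp (\<nu>\<^sup>2 / 2) * (C * s) \<le> \<alpha> * c / (2 * sqrt 2)"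
    and x: "\<alpha> < mx f x"
  shows "\<alpha> * c / (2 * sqrt 2) \<le> exp (x\<^sup>2 / 2) * (C * s / \<nu>)"
proof (cases "x\<^sup>2 \<le> 2 * \<nu>\<^sup>2")
  case True
  have "0 < c / sqrt 2" using pos by simp
  with mx_den_ge[OF f c2, of x] have den: "0 < mx_den f x" by linarith
  have "\<alpha> * (c / sqrt 2) \<le> \<alpha> * mx_den f x"
    using mx_den_ge[OF f c2, of x] pos by (intro mult_left_mono) auto
  also have "\<dots> < mx_num f x"
    using x den by (simp add: mx_eq less_divide_eq)
  also have "\<dots> \<le> s * exp (s * \<nu>\<^sup>2) + exp (\<nu>\<^sup>2 / 2) * (C * s) + exp (x\<^sup>2 / 2) * (C * s / \<nu>)"
    using mx_num_le[OF f c3, of x] \<nu> s True unfolding \<nu>_def s_def by blast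
  finally show ?thesis using small by simp
next
  case False
  have n: "0 < n" using np by simp
  have "\<nu>\<^sup>2 = ln (real n / real p)"
    using \<nu> unfolding \<nu>_def nu_def by auto
  then have e: "exp (\<nu>\<^sup>2) = real n / real p" using np n by simp
  have "\<alpha> * c / (2 * sqrt 2) \<le> C * \<nu>" by (rule \<nu>)
  also have "\<dots> = exp (\<nu>\<^sup>2) * (C * s / \<nu>)"
    using \<nu> np n unfolding e by (simp add: s_def s_n_def tau_def \<nu>_def[symmetric] power2_eq_square)
  also have "\<dots> \<le> exp (x\<^sup>2 / 2) * (C * s / \<nu>)"
    using False pos s \<nu> by (intro mult_right_mono) auto
  finally show ?thesis .
qed

lemma type1_error_le:
  fixes n p :: nat
  defines "\<nu> \<equiv> nu n p" and "s \<equiv> s_n n p"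
  assumes f: "is_prior_density f" and c2: "cond2 c f" and c3: "cond3 C f n p"
    and pos: "0 < \<alpha>" "0 < c" "0 < C" and np: "1 \<le> p" "p \<le> n"
    and \<nu>: "1 \<le> \<nu>" "\<alpha> * c / (2 * sqrt 2) \<le> C * \<nu>" and s: "0 < s" "s \<le> 1"
    and small: "s * exp (s * \<nu>\<^sup>2) + exp (\<nu>\<^sup>2 / 2) * (C * s) \<le> \<alpha> * c / (2 * sqrt 2)"
  shows "measure (density lborel (normal_density 0 1)) {x. \<alpha> < mx f x}
    \<le> 8 * C * sqrt pi / (\<alpha> * c) * tau n p"
proof -
  \<comment> \<open>\<open>a\<close> is the size of \<open>exp (x\<^sup>2 / 2)\<close> that a
    rejection forces and \<open>t\<close> the matching size of \<open>\<bar>x\<bar>\<close>, so the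
    density at \<open>t\<close> is \<open>1 / (sqrt (2 * pi) * a)\<close>.\<close>
  define a where "a = \<alpha> * c / (2 * sqrt 2) * \<nu> / (C * s)"
  define t where "t = sqrt (2 * ln a)"
  have a0: "0 < \<alpha> * c / (2 * sqrt 2)" using pos by simp
  have "0 < s * exp (s * \<nu>\<^sup>2)" using s by simp
  then have "exp (\<nu>\<^sup>2 / 2) * (C * s) \<le> \<alpha> * c / (2 * sqrt 2)" using small by linarith
  also have "\<dots> \<le> \<alpha> * c / (2 * sqrt 2) * \<nu>" using mult_left_mono[OF \<nu>(1), of "\<alpha> * c / (2 * sqrt 2)"] a0 by simp
  \<comment> \<open>The smallness assumption also bounds \<open>a\<close> from below, whence
    \<open>\<nu> \<le> t\<close>: the factor \<open>1 / t\<close> of the Mills bound may be replaced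
    by \<open>1 / \<nu>\<close>.\<close>
  finally have ea: "exp (\<nu>\<^sup>2 / 2) \<le> a"
    using mult_pos_pos[OF pos(3) s(1)] unfolding a_def by (simp only: pos_le_divide_eq)
  then have a: "0 < a" using exp_gt_zero less_le_trans by blast
  have lna: "\<nu>\<^sup>2 / 2 \<le> ln a" using ln_ge_iff[OF a] ea by blast
  have \<nu>2: "1 \<le> \<nu>\<^sup>2" using \<nu> by simp
  have t\<nu>: "\<nu> \<le> t" unfolding t_def using lna by (intro real_le_rsqrt) auto
  have t2: "t\<^sup>2 = 2 * ln a" unfolding t_def using lna \<nu>2 by simp
  have sub: "{x. \<alpha> < mx f x} \<subseteq> {x. t \<le> \<bar>x - 0\<bar>}"
  proof clarsimp
    fix x assume "\<alpha> < mx f x"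
    then have "\<alpha> * c / (2 * sqrt 2) \<le> exp (x\<^sup>2 / 2) * (C * s / \<nu>)"
      using rejection_imp_large[OF f c2 c3 pos np, of x] \<nu> s small unfolding \<nu>_def s_def by blast
    then have "a \<le> exp (x\<^sup>2 / 2)"
      using pos s \<nu> by (simp add: a_def divide_simps mult_ac)
    then have "ln a \<le> x\<^sup>2 / 2" using a ln_le_cancel_iff[of a "exp (x\<^sup>2/2)"] by simp
    then have "t\<^sup>2 \<le> x\<^sup>2" using t2 by simp
    then show "t \<le> \<bar>x\<bar>" using abs_le_square_iff[of t x] t\<nu> \<nu> by linarith
  qed
  have "measure (density lborel (normal_density 0 1)) {x. \<alpha> < mx f x}
      \<le> measure (density lborel (normal_density 0 1)) {x. t \<le> \<bar>x - 0\<bar>}"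
  proof -
    interpret N: prob_space "density lborel (normal_density 0 1)"
      by (rule prob_space_normal_density) simp
    show ?thesis by (rule N.finite_measure_mono[OF sub]) auto
  qed
  also have "\<dots> \<le> 2 * (std_normal_density t / t)"
    using t\<nu> \<nu> by (intro normal_tail) linarith
  also have "std_normal_density t = 1 / sqrt (2 * pi) / a"
    unfolding std_normal_density_def using a by (simp add: t2 exp_minus inverse_eq_divide)
  also have "1 / sqrt (2 * pi) / a / t \<le> 1 / sqrt (2 * pi) / a / \<nu>"
    using t\<nu> \<nu> a by (intro divide_left_mono) auto
  also have "2 * (1 / sqrt (2 * pi) / a / \<nu>) = 4 * C / (sqrt pi * \<alpha> * c) * tau n p"
    unfolding a_def using pos \<nu> s
    by (simp add: real_sqrt_mult s_def s_n_def \<nu>_def[symmetric] field_simps power2_eq_square)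
  \<comment> \<open>The constant obtained has \<open>4 / sqrt pi\<close>; it is relaxed to the
    \<open>8 * sqrt pi\<close> of the target, since 4 is below 8 times pi.\<close>
  also have "\<dots> \<le> 8 * C * sqrt pi / (\<alpha> * c) * tau n p"
  proof (intro mult_right_mono)
    have "4 \<le> 8 * (sqrt pi * sqrt pi)" using pi_gt3 by simp
    then have "4 / sqrt pi \<le> 8 * sqrt pi" by (simp add: divide_le_eq mult.assoc)
    then have "4 / sqrt pi * (C / (\<alpha> * c)) \<le> 8 * sqrt pi * (C / (\<alpha> * c))"
      using pos by (intro mult_right_mono) auto
    then show "4 * C / (sqrt pi * \<alpha> * c) \<le> 8 * C * sqrt pi / (\<alpha> * c)" by (simp add: mult_ac)
  qed (simp add: tau_def)
  finally show ?thesis by simp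
qed

section \<open>Type II error\<close>

text \<open>The ratio bound for \<open>L\<close> with factor 2 is iterated along \<open>u\<close>,
  \<open>2 * u\<close>, and so on, losing \<open>R\<close> each time. The factor
  \<open>exp (- b * u)\<close> contained in \<open>f u\<close> is bounded by 1.\<close>

lemma cond1_doubling:
  assumes f: "is_prior_density f" and c1: "cond1 b R u0 C' b' K ustar f n p"
    and "0 < R" "0 < u0" "0 \<le> b" "u0 \<le> u"
  shows "f u * exp (- b * 2 ^ k * u) / R ^ k \<le> f (2 ^ k * u)"
proof -
  obtain L where L: "\<And>u. 0 < u \<Longrightarrow> f u = L u * exp (- b * u)"
    and rv: "\<And>a u. a \<in> {1..2} \<Longrightarrow> u0 \<le> u \<Longrightarrow> 1 / R \<le> L (a * u) / L u"
    using c1 unfolding cond1_def by blast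
  have u: "0 < u" using assms by linarith
  have Lpos: "0 < L v" if "u0 \<le> v" for v
  proof -
    have v: "0 < v" using that \<open>0 < u0\<close> by linarith
    have "0 \<le> f v"
      using f v by (simp add: is_prior_density_def)
    then have "0 \<le> L v * exp (- b * v)"
      by (simp only: L[OF v])
    \<comment> \<open>If \<open>L v\<close> were 0, the ratio with factor 1 would be
      \<open>0 / 0 = 0\<close>, below \<open>1 / R\<close>.\<close>
    moreover have "L v \<noteq> 0" using rv[of 1 v] that \<open>0 < R\<close> by auto
    ultimately show ?thesis by (simp add: zero_le_mult_iff)
  qed
  have ge: "u0 \<le> 2 ^ k * u" for k
  proof -
    have "1 * u \<le> 2 ^ k * u" using u by (intro mult_right_mono one_le_power) auto
    then show ?thesis using \<open>u0 \<le> u\<close> by linarith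
  qed
  have Lk: "L u / R ^ k \<le> L (2 ^ k * u)"
  proof (induction k)
    case (Suc k)
    have "L (2 ^ k * u) / R \<le> L (2 * (2 ^ k * u))"
      using rv[of 2 "2 ^ k * u"] Lpos[OF ge[of k]] ge[of k] by (simp add: le_divide_eq)
    moreover have "L u / R ^ k / R \<le> L (2 ^ k * u) / R"
      using Suc \<open>0 < R\<close> by (intro divide_right_mono) auto
    ultimately show ?case by (simp add: mult_ac)
  qed simp
  have "f u * exp (- b * 2 ^ k * u) / R ^ k
      = L u / R ^ k * exp (- b * (2 ^ k * u)) * exp (- b * u)"
    using L[OF u] by (simp add: mult_ac)
  also have "\<dots> \<le> L u / R ^ k * exp (- b * (2 ^ k * u)) * 1"
    using \<open>0 \<le> b\<close> u Lpos[OF \<open>u0 \<le> u\<close>] \<open>0 < R\<close> by (intro mult_left_mono) auto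
  also have "\<dots> \<le> L (2 ^ k * u) * exp (- b * (2 ^ k * u))"
    unfolding mult_1_right by (rule mult_right_mono[OF Lk exp_ge_zero])
  also have "\<dots> = f (2 ^ k * u)"
    using L[of "2 ^ k * u"] u by simp
  finally show ?thesis .
qed

section \<open>The tilted prior and the sign of its centred mean\<close>

definition tilt :: "real \<Rightarrow> real \<Rightarrow> real" where
  "tilt x u = (1 + u) powr (-3/2) * exp (x\<^sup>2 / 2 * (u / (1 + u)))"

lemma tilt_nonneg: "0 \<le> tilt x u"
  by (simp add: tilt_def)

lemma tilt_measurable [measurable]: "tilt x \<in> borel_measurable borel"
  unfolding tilt_def[abs_def] by simp

lemma odds_weight_integrable:
  assumes f: "is_prior_density f"
  shows "integrable lborel (\<lambda>u. (u - B) * tilt x u * prior_ext f u)"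
proof -
  have "integrable lborel (\<lambda>u. B * tilt x u * prior_ext f u)"
  proof (rule prior_ext_weight_integrable[OF f, where B = "\<bar>B\<bar> * (1 * exp (x\<^sup>2 / 2))"])
    fix u :: real assume u: "0 < u"
    have "(1 + u) powr (-3/2) * exp (x\<^sup>2 / 2 * (u / (1 + u))) \<le> 1 * exp (x\<^sup>2 / 2)"
      using shrinkage_exponent_le[OF u, of x] powr_le_one_of_nonpos[OF u, of "-3/2"]
      by (intro mult_mono) auto
    then show "\<bar>B * tilt x u\<bar> \<le> \<bar>B\<bar> * (1 * exp (x\<^sup>2 / 2))"
      unfolding abs_mult tilt_def by (intro mult_left_mono) auto
  qed simp
  from Bochner_Integration.integrable_diff[OF mx_num_integrable[OF f, of x] this]
  show ?thesis by (simp add: tilt_def algebra_simps)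
qed

text \<open>The weights of numerator and denominator are \<open>u * tilt x u\<close> and
  \<open>(1 + u) * tilt x u\<close>, and \<open>u - \<alpha> * (1 + u)\<close> is
  \<open>1 - \<alpha>\<close> times \<open>u - \<alpha> / (1 - \<alpha>)\<close>. Raising the centre
  to \<open>B\<close> only lowers the integral.\<close>

lemma mx_gt_of_odds:
  assumes f: "is_prior_density f" and \<alpha>: "0 < \<alpha>" "\<alpha> < 1" and B: "\<alpha> / (1 - \<alpha>) \<le> B"
    and pos: "0 < (\<integral>u. (u - B) * tilt x u * prior_ext f u \<partial>lborel)"
  shows "\<alpha> < mx f x"
proof -
  let ?A = "\<alpha> / (1 - \<alpha>)"
  have "0 < (\<integral>u. (u - B) * tilt x u * prior_ext f u \<partial>lborel)" by (rule pos)
  also have "\<dots> \<le> (\<integral>u. (u - ?A) * tilt x u * prior_ext f u \<partial>lborel)"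
    using B by (intro integral_mono odds_weight_integrable[OF f] mult_right_mono
      prior_ext_nonneg[OF f] tilt_nonneg) auto
  finally have "0 < (1 - \<alpha>) * (\<integral>u. (u - ?A) * tilt x u * prior_ext f u \<partial>lborel)"
    using \<alpha> by simp
  also have "\<dots> = (\<integral>u. (1 - \<alpha>) * ((u - ?A) * tilt x u * prior_ext f u) \<partial>lborel)"
    by simp
  also have "\<dots> = (\<integral>u. u * (1 + u) powr (-3/2) * exp (x\<^sup>2 / 2 * (u / (1 + u))) * prior_ext f u
      - \<alpha> * ((1 + u) powr (-1/2) * exp (x\<^sup>2 / 2 * (u / (1 + u))) * prior_ext f u) \<partial>lborel)"
  proof (intro Bochner_Integration.integral_cong refl)
    fix u :: real
    show "(1 - \<alpha>) * ((u - ?A) * tilt x u * prior_ext f u)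
      = u * (1 + u) powr (-3/2) * exp (x\<^sup>2 / 2 * (u / (1 + u))) * prior_ext f u
      - \<alpha> * ((1 + u) powr (-1/2) * exp (x\<^sup>2 / 2 * (u / (1 + u))) * prior_ext f u)"
    proof (cases "0 < u")
      case True
      have "(1 + u) powr (-1/2) = (1 + u) powr 1 * (1 + u) powr (-3/2)"
        by (subst powr_add[symmetric]) simp
      then have half: "(1 + u) powr (-1/2) = (1 + u) * (1 + u) powr (-3/2)"
        using True by simp
      have "(1 - \<alpha>) * (u - ?A) = u - \<alpha> * (1 + u)"
        using \<alpha> by (simp add: field_simps)
      then have "(1 - \<alpha>) * ((u - ?A) * tilt x u * prior_ext f u)
        = (u - \<alpha> * (1 + u)) * (tilt x u * prior_ext f u)"
        by (simp only: mult.assoc[symmetric])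
      then show ?thesis unfolding half tilt_def by (simp add: algebra_simps)
    qed (simp add: prior_ext_def)
  qed
  also have "\<dots> = mx_num f x - \<alpha> * mx_den f x"
    unfolding mx_num_def mx_den_def
    by (simp only: integral_mult_right_zero Bochner_Integration.integral_diff
      [OF mx_num_integrable[OF f] integrable_mult_right[OF mx_den_integrable[OF f]]])
  finally have lt: "\<alpha> * mx_den f x < mx_num f x" by simp
  have "0 \<le> mx_den f x" unfolding mx_den_def
    by (intro integral_nonneg_AE AE_I2 mult_nonneg_nonneg prior_ext_nonneg[OF f]) auto
  \<comment> \<open>Rules out the default value of division by zero: the numerator is at most the
    denominator, so both could not be zero and satisfy \<open>lt\<close>.\<close>
  moreover have "mx_den f x \<noteq> 0"
  proof
    assume 0: "mx_den f x = 0"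
    have "mx_num f x \<le> mx_den f x" unfolding mx_num_def mx_den_def
    proof (intro integral_mono mx_num_integrable[OF f] mx_den_integrable[OF f])
      fix u :: real
      show "u * (1 + u) powr (-3/2) * exp (x\<^sup>2 / 2 * (u / (1 + u))) * prior_ext f u
        \<le> (1 + u) powr (-1/2) * exp (x\<^sup>2 / 2 * (u / (1 + u))) * prior_ext f u"
      proof (cases "0 < u")
        case True
        then show ?thesis
          by (intro mult_right_mono mul_powr_three_halves prior_ext_nonneg[OF f]) auto
      qed (simp add: prior_ext_def)
    qed
    with lt 0 show False by simp
  qed
  ultimately have "0 < mx_den f x" by simp
  then show ?thesis using lt by (simp add: mx_eq less_divide_eq)
qed

text \<open>The increment of \<open>u / (1 + u)\<close> under dilation by \<open>q\<close> is
  bounded below on \<open>{u0..B}\<close>, so the tilt gains a factor exponential in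
  \<open>x\<^sup>2\<close>; the power factor loses at most \<open>q ^ 2\<close>.\<close>

lemma tilt_scaled_ge:
  fixes q u x B u0 :: real
  assumes q: "1 \<le> q" and u: "0 < u0" "u0 \<le> u" "u \<le> B"
  shows "tilt x u * exp (x\<^sup>2 / 2 * ((q - 1) * u0 / ((1 + q * B) * (1 + B)))) / q ^ 2 \<le> tilt x (q * u)"
proof -
  have u': "0 < u" and B: "0 < B" and q0: "0 < q" using u q by linarith+
  have "(1 + q * u) \<le> q * (1 + u)" using q by (simp add: algebra_simps)
  then have "(q * (1 + u)) powr (-3/2) \<le> (1 + q * u) powr (-3/2)"
    using q0 u' by (intro powr_mono2') (auto simp: add_pos_pos)
  moreover have "q powr (-2) \<le> q powr (-3/2)" using q by (intro powr_mono) auto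
  then have "1 / q ^ 2 * (1 + u) powr (-3/2) \<le> q powr (-3/2) * (1 + u) powr (-3/2)"
    using q0 by (intro mult_right_mono) (auto simp: powr_minus inverse_eq_divide)
  moreover have "(q * (1 + u)) powr (-3/2) = q powr (-3/2) * (1 + u) powr (-3/2)"
    using q0 u' by (simp add: powr_mult)
  ultimately have p: "1 / q ^ 2 * (1 + u) powr (-3/2) \<le> (1 + q * u) powr (-3/2)" by linarith
  have qu: "0 < 1 + q * u" using q0 u' by (simp add: add_pos_pos)
  have "(q - 1) * u0 / ((1 + q * B) * (1 + B)) \<le> (q - 1) * u / ((1 + q * u) * (1 + u))"
    using u u' q q0 B by (intro frac_le mult_mono mult_nonneg_nonneg mult_pos_pos add_mono mult_left_mono) (auto simp: add_pos_pos)
  also have "\<dots> = q * u / (1 + q * u) - u / (1 + u)"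
    using qu u' by (simp add: divide_simps) (simp add: algebra_simps)
  finally have "x\<^sup>2 / 2 * ((q - 1) * u0 / ((1 + q * B) * (1 + B)))
      \<le> x\<^sup>2 / 2 * (q * u / (1 + q * u) - u / (1 + u))"
    by (intro mult_left_mono) auto
  then have "x\<^sup>2 / 2 * (u / (1 + u)) + x\<^sup>2 / 2 * ((q - 1) * u0 / ((1 + q * B) * (1 + B)))
      \<le> x\<^sup>2 / 2 * (q * u / (1 + q * u))"
    by (simp only: right_diff_distrib)
  then have e: "exp (x\<^sup>2 / 2 * (u / (1 + u))) * exp (x\<^sup>2 / 2 * ((q - 1) * u0 / ((1 + q * B) * (1 + B))))
      \<le> exp (x\<^sup>2 / 2 * (q * u / (1 + q * u)))"
    by (simp only: exp_add[symmetric] exp_le_cancel_iff)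
  have "tilt x u * exp (x\<^sup>2 / 2 * ((q - 1) * u0 / ((1 + q * B) * (1 + B)))) / q ^ 2
      = (1 / q ^ 2 * (1 + u) powr (-3/2)) *
        (exp (x\<^sup>2 / 2 * (u / (1 + u))) * exp (x\<^sup>2 / 2 * ((q - 1) * u0 / ((1 + q * B) * (1 + B)))))"
    by (simp only: tilt_def times_divide_eq_left times_divide_eq_right mult_1_left mult.assoc)
  also have "\<dots> \<le> (1 + q * u) powr (-3/2) * exp (x\<^sup>2 / 2 * (q * u / (1 + q * u)))"
    using p e by (intro mult_mono) auto
  finally show ?thesis by (simp add: tilt_def)
qed

text \<open>The tail block \<open>{q * u0..<q * B}\<close> of the prior, the dilate of \<open>{u0..<B}\<close> by \<open>q = 2 ^ k\<close>,
  outweighs \<open>{u0..<B}\<close>; the block \<open>{z..z + 1}\<close> with \<open>z = \<bar>x\<bar> / sqrt 2\<close>, on which only the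
  lower bound of \<open>cond1\<close> is available, outweighs \<open>{0<..<u0}\<close>.\<close>
lemma odds_integral_pos:
  fixes B q u0 x z h0 h1 :: real
  assumes f: "is_prior_density f"
    and u0: "0 < u0" "u0 \<le> B" and q: "1 \<le> q" "2 * B \<le> q * u0"
    and z: "q * B \<le> z" "B + 1 \<le> z"
    and dil: "\<And>u. u0 \<le> u \<Longrightarrow> u \<le> B \<Longrightarrow> tilt x u * f u \<le> q * (tilt x (q * u) * f (q * u))"
    and low: "\<And>u. 0 < u \<Longrightarrow> u < u0 \<Longrightarrow> B * tilt x u \<le> h0"
    and high: "\<And>u. z \<le> u \<Longrightarrow> u \<le> z + 1 \<Longrightarrow> h1 \<le> tilt x u * f u"
    and h: "0 \<le> h0" "h0 < h1"
  shows "0 < (\<integral>u. (u - B) * tilt x u * prior_ext f u \<partial>lborel)"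
proof -
  let ?Q = "\<lambda>u. (u - B) * tilt x u * prior_ext f u"
  let ?a = "\<lambda>u. indicator {q * u0..<q * B} u * ?Q u"
  let ?b = "\<lambda>u. indicator {u0..<B} u * ?Q u"
  let ?c = "\<lambda>u. indicator {z..z + 1} u * h1"
  let ?d = "\<lambda>u. h0 * prior_ext f u"
  have q0: "0 < q" and B: "0 < B" using q u0 by linarith+
  have "B < q * u0" using q B by linarith
  have iQ: "integrable lborel ?Q" by (rule odds_weight_integrable[OF f])
  have ia: "integrable lborel ?a" and ib: "integrable lborel ?b"
    using integrable_mult_indicator[OF _ iQ, of "{q * u0..<q * B}"]
      integrable_mult_indicator[OF _ iQ, of "{u0..<B}"] by simp_all
  have ic: "integrable lborel ?c" by (intro integrable_mult_left) auto
  have id: "integrable lborel ?d" using prior_ext_integrable[OF f] by simp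
  have iaq: "integrable lborel (\<lambda>u. ?a (0 + q * u))"
    using ia q0 by (intro lborel_integrable_real_affine) auto
  \<comment> \<open>The substitution of \<open>q * u\<close>, with Jacobian \<open>q\<close>,
    carries the dilated block back to \<open>{u0..<B}\<close>, so the two blocks are compared
    pointwise.\<close>
  have "0 \<le> (\<integral>u. q * ?a (0 + q * u) + ?b u \<partial>lborel)"
  proof (intro integral_nonneg_AE AE_I2)
    fix u
    have ind: "(q * u \<in> {q * u0..<q * B}) = (u \<in> {u0..<B})" using q0 by simp
    show "0 \<le> q * ?a (0 + q * u) + ?b u"
    proof (cases "u \<in> {u0..<B}")
      case True
      then have u: "0 < u" "u0 \<le> u" "u < B" and qu: "0 < q * u" using u0 q0 by auto
      have fu: "0 \<le> f u" "0 \<le> f (q * u)"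
        using f u qu by (auto simp: is_prior_density_def)
      have "q * u0 \<le> q * u" using u q0 by simp
      \<comment> \<open>The choice \<open>2 * B \<le> q * u0\<close> makes the excess over
        \<open>B\<close> at the dilated point at least the deficit at \<open>u\<close>.\<close>
      then have "B - u \<le> q * u - B" using q u by linarith
      then have "(B - u) * (tilt x u * f u) \<le> (q * u - B) * (q * (tilt x (q * u) * f (q * u)))"
        by (rule mult_mono) (use dil[OF u(2)] \<open>B - u \<le> q * u - B\<close> u fu in \<open>auto intro!: mult_nonneg_nonneg tilt_nonneg\<close>)
      then show ?thesis using True ind u qu by (simp add: prior_ext_pos algebra_simps)
    next
      case False
      then show ?thesis using ind by simp
    qed
  qed
  also have "\<dots> = q * (\<integral>u. ?a (0 + q * u) \<partial>lborel) + (\<integral>u. ?b u \<partial>lborel)"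
    using iaq ib by (simp del: add_0_left)
  also have "q * (\<integral>u. ?a (0 + q * u) \<partial>lborel) = (\<integral>u. ?a u \<partial>lborel)"
    using lborel_integral_real_affine[of q ?a 0] q0 by simp
  finally have ab: "0 \<le> (\<integral>u. ?a u \<partial>lborel) + (\<integral>u. ?b u \<partial>lborel)" .
  \<comment> \<open>The block at \<open>z\<close> contributes \<open>h1\<close> because it has
    length 1; the loss is charged at \<open>h0\<close> because the prior has total mass 1.\<close>
  have "0 < h1 - h0" using h by simp
  also have "\<dots> \<le> (\<integral>u. ?a u \<partial>lborel) + (\<integral>u. ?b u \<partial>lborel) + (h1 - h0)" using ab by simp
  also have "\<dots> = (\<integral>u. ?a u + ?b u + ?c u - ?d u \<partial>lborel)"
  proof -
    have "(\<integral>u. ?c u \<partial>lborel) = h1"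
      by (subst Bochner_Integration.integral_mult_left) auto
    moreover have "(\<integral>u. ?d u \<partial>lborel) = h0"
      using prior_ext_integral[OF f] by simp
    ultimately show ?thesis
      using ia ib ic id by (simp del: integral_mult_right_zero integral_mult_left_zero)
  qed
  also have "\<dots> \<le> (\<integral>u. ?Q u \<partial>lborel)"
  proof (rule integral_mono[OF _ iQ])
    show "integrable lborel (\<lambda>u. ?a u + ?b u + ?c u - ?d u)"
      using ia ib ic id by (intro Bochner_Integration.integrable_diff Bochner_Integration.integrable_add)
    fix u :: real
    have F: "0 \<le> prior_ext f u" by (rule prior_ext_nonneg[OF f])
    have d: "0 \<le> ?d u" using F h by simp
    \<comment> \<open>Half-open blocks and \<open>q * B \<le> z\<close> keep the regions disjoint.
      On the block at \<open>z\<close> the weight \<open>u - B\<close> is at least 1; on the rest of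
      \<open>{B..}\<close> the integrand is nonnegative.\<close>
    consider "u \<le> 0" | "0 < u" "u < u0" | "u0 \<le> u" "u < B" | "B \<le> u" "u < q * B" | "q * B \<le> u"
      by linarith
    then show "?a u + ?b u + ?c u - ?d u \<le> ?Q u"
    proof cases
      case 1
      then show ?thesis using u0 B z \<open>B < q * u0\<close> by (simp add: prior_ext_def)
    next
      case 2
      have "(B - u) * tilt x u \<le> B * tilt x u"
        using 2 by (intro mult_right_mono tilt_nonneg) auto
      then have "(B - u) * tilt x u \<le> h0" using low[OF 2] by linarith
      then have "(B - u) * tilt x u * prior_ext f u \<le> ?d u" using F by (rule mult_right_mono)
      then show ?thesis using 2 u0 z \<open>B < q * u0\<close> by (simp add: algebra_simps)
    next
      case 3
      then show ?thesis using d z \<open>B < q * u0\<close> by simp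
    next
      case 4
      have "0 \<le> ?Q u" using 4 F by (intro mult_nonneg_nonneg tilt_nonneg) auto
      then show ?thesis using 4 d z by (auto simp: indicator_def)
    next
      case 5
      have "B \<le> q * B" using q B by simp
      then have uB: "B \<le> u" using 5 by linarith
      have Q: "0 \<le> ?Q u" using uB F by (intro mult_nonneg_nonneg tilt_nonneg) auto
      show ?thesis
      proof (cases "u \<in> {z..z + 1}")
        case True
        then have u: "0 < u" "1 \<le> u - B" using z B by auto
        have "0 \<le> f u" using f u by (simp add: is_prior_density_def)
        then have "1 * (tilt x u * f u) \<le> (u - B) * (tilt x u * f u)"
          using u by (intro mult_right_mono mult_nonneg_nonneg tilt_nonneg) auto
        moreover have "h1 \<le> tilt x u * f u" using True by (intro high) auto
        ultimately have "h1 \<le> ?Q u" using u by (simp add: prior_ext_pos mult.assoc)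
        then show ?thesis using True 5 d uB by simp
      next
        case False
        then show ?thesis using 5 d Q uB by (auto simp: indicator_def)
      qed
    qed
  qed
  finally show ?thesis .
qed

text \<open>\<open>W\<close> is chosen before \<open>f\<close>, \<open>n\<close>, \<open>p\<close>,
  \<open>K\<close>, \<open>x\<close> and is thus uniform in them. With
  \<open>z = \<bar>x\<bar> / sqrt 2\<close>, the region below \<open>u0\<close> weighs about
  \<open>exp (z\<^sup>2 * (u0 / (1 + u0)))\<close> and the block at \<open>z\<close> about
  \<open>tau n p powr K * exp (z\<^sup>2)\<close>, up to exponentials linear in \<open>z\<close>.
  Hence \<open>z\<^sup>2 / (1 + u0)\<close> must beat \<open>K * ln (1 / tau n p)\<close>, which
  explains the square root.\<close>

lemma mx_gt_if_large:
  fixes \<alpha> ustar u0 R b b' C' :: real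
  assumes \<alpha>: "0 < \<alpha>" "\<alpha> < 1"
    and "0 < R" "0 < u0" "0 \<le> b" "0 < b'" "0 < C'" "1 \<le> ustar"
  shows "\<exists>W>0. \<forall>f n p K x. is_prior_density f \<longrightarrow> cond1 b R u0 C' b' K ustar f n p \<longrightarrow>
    0 < tau n p \<longrightarrow> tau n p \<le> 1 \<longrightarrow> 0 \<le> K \<longrightarrow>
    sqrt (K * (u0 + 1) * ln (1 / tau n p)) + W \<le> \<bar>x\<bar> / sqrt 2 \<longrightarrow> \<alpha> < mx f x"
proof -
  \<comment> \<open>\<open>B\<close> dominates the odds of \<alpha>, and is at least
    \<open>u0\<close> so that \<open>{u0..B}\<close> lies where doubling applies.\<close>
  define B where "B = max (\<alpha> / (1 - \<alpha>)) u0"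
  have B: "\<alpha> / (1 - \<alpha>) \<le> B" "u0 \<le> B" by (simp_all add: B_def)
  have B0: "0 < B" using B \<open>0 < u0\<close> by linarith
  obtain k where k: "2 * B / u0 < 2 ^ k" using real_arch_pow[of 2 "2 * B / u0"] by auto
  define q :: real where "q = 2 ^ k"
  have q1: "1 \<le> q" by (simp add: q_def)
  have qB: "2 * B \<le> q * u0" using k \<open>0 < u0\<close> by (simp add: q_def divide_less_eq)
  have "q * u0 \<le> q * B" using B q1 by (intro mult_left_mono) auto
  then have "2 * B \<le> q * B" using qB by linarith
  then have q2: "2 \<le> q" using B0 by simp
  define \<eta> where "\<eta> = (q - 1) * u0 / ((1 + q * B) * (1 + B))"
  have \<eta>: "0 < \<eta>"
    unfolding \<eta>_def using q2 B0 \<open>0 < u0\<close> by (intro divide_pos_pos mult_pos_pos add_pos_pos) auto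
  \<comment> \<open>\<open>E\<close> collects the net losses of passing from \<open>u\<close> to
    \<open>q * u\<close>: power factor against Jacobian, the \<open>k\<close> doublings, and the
    exponential of Condition 1.\<close>
  define E where "E = q * R ^ k * exp (b * q * B)"
  have E: "0 < E" using q2 \<open>0 < R\<close> by (simp add: E_def)
  \<comment> \<open>The slope outweighs every linear term in the final comparison of
    \<open>?h0\<close> and \<open>?h1\<close>; the factor \<open>1 + u0\<close> cancels the division
    of \<open>z\<^sup>2\<close> by \<open>1 + u0\<close>.\<close>
  define W2 where "W2 = (1 + u0) * (6 + 2 * b' + \<bar>ln (B * C')\<bar>)"
  have W2: "0 \<le> W2" using assms by (simp add: W2_def)
  define W where "W = q * B + (B + 1) + ustar + \<bar>ln E / \<eta>\<bar> + W2"
  have W: "0 < W" "q * B \<le> W" "B + 1 \<le> W" "ustar \<le> W" "ln E / \<eta> \<le> W" "W2 \<le> W"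
    using B0 \<open>1 \<le> ustar\<close> W2 \<open>2 * B \<le> q * B\<close> abs_ge_self[of "ln E / \<eta>"]
      abs_ge_zero[of "ln E / \<eta>"] unfolding W_def by linarith+
  show ?thesis
  proof (intro exI[of _ W] conjI W(1) allI impI)
    fix f n p K x
    assume f: "is_prior_density f" and c1: "cond1 b R u0 C' b' K ustar f n p"
      and \<tau>: "0 < tau n p" "tau n p \<le> 1" and K: "0 \<le> K"
      and x: "sqrt (K * (u0 + 1) * ln (1 / tau n p)) + W \<le> \<bar>x\<bar> / sqrt 2"
    define z where "z = \<bar>x\<bar> / sqrt 2"
    define l where "l = ln (1 / tau n p)"
    define a where "a = sqrt (K * (u0 + 1) * l)"
    have l: "0 \<le> l" using \<tau> by (simp add: l_def)
    have a: "0 \<le> a" "a\<^sup>2 = K * (u0 + 1) * l"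
      using l K \<open>0 < u0\<close> by (simp_all add: a_def)
    have z: "a + W \<le> z" using x by (simp add: z_def a_def l_def)
    have zW: "W \<le> z" using z a by linarith
    have z1: "1 \<le> z" using zW W \<open>1 \<le> ustar\<close> by linarith
    have z2: "x\<^sup>2 / 2 = z\<^sup>2" by (simp add: z_def power_divide)
    have zz: "z \<le> z\<^sup>2" using z1 by (simp add: power2_eq_square)
    have ez: "E \<le> exp (z\<^sup>2 * \<eta>)"
    proof -
      have "ln E / \<eta> \<le> z\<^sup>2" using W zW zz by linarith
      then have "ln E \<le> z\<^sup>2 * \<eta>" using \<eta> by (simp add: divide_le_eq)
      then show ?thesis using ln_ge_iff E by (metis exp_le_cancel_iff exp_ln)
    qed
    let ?h0 = "B * exp (z\<^sup>2 * (u0 / (1 + u0)))"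
    let ?h1 = "exp (- 2 * (z + 1)) * exp (z\<^sup>2 - z) * (tau n p powr K * exp (- b' * (z + 1)) / C')"
    have "0 < (\<integral>u. (u - B) * tilt x u * prior_ext f u \<partial>lborel)"
    proof (rule odds_integral_pos[where q = q and z = z and ?h0.0 = ?h0 and ?h1.0 = ?h1])
      show "is_prior_density f" "0 < u0" "u0 \<le> B" "1 \<le> q" "2 * B \<le> q * u0" by fact+
      show "q * B \<le> z" "B + 1 \<le> z" using W zW by linarith+
    next
      fix u assume u: "u0 \<le> u" "u \<le> B"
      have u0': "0 < u" using u \<open>0 < u0\<close> by linarith
      have fu: "0 \<le> f u" using f u0' by (simp add: is_prior_density_def)
      have t: "tilt x u * exp (z\<^sup>2 * \<eta>) / q ^ 2 \<le> tilt x (q * u)"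
        using tilt_scaled_ge[OF q1 \<open>0 < u0\<close> u, of x] unfolding z2 \<eta>_def .
      have "b * q * u \<le> b * q * B" using u q1 \<open>0 \<le> b\<close> by (intro mult_left_mono) auto
      then have "f u * exp (- (b * q * B)) / R ^ k \<le> f u * exp (- b * q * u) / R ^ k"
        using fu \<open>0 < R\<close> by (intro divide_right_mono mult_left_mono) auto
      also have "\<dots> \<le> f (q * u)"
        unfolding q_def by (rule cond1_doubling[OF f c1 \<open>0 < R\<close> \<open>0 < u0\<close> \<open>0 \<le> b\<close> u(1)])
      finally have d: "f u * exp (- (b * q * B)) / R ^ k \<le> f (q * u)" .
      have "tilt x u * f u * 1 \<le> tilt x u * f u * (exp (z\<^sup>2 * \<eta>) / E)"
        using ez E fu tilt_nonneg[of x u] by (intro mult_left_mono) auto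
      also have "\<dots> = q * (tilt x u * exp (z\<^sup>2 * \<eta>) / q ^ 2 * (f u * exp (- (b * q * B)) / R ^ k))"
        using q2 by (simp add: E_def exp_minus divide_simps power2_eq_square)
      also have "\<dots> \<le> q * (tilt x (q * u) * f (q * u))"
        using t d q2 fu \<open>0 < R\<close>
        by (intro mult_left_mono mult_mono tilt_nonneg) (auto intro!: divide_nonneg_nonneg mult_nonneg_nonneg)
      finally show "tilt x u * f u \<le> q * (tilt x (q * u) * f (q * u))" by simp
    next
      fix u assume u: "0 < u" "u < u0"
      have "u / (1 + u) \<le> u0 / (1 + u0)" using u by (simp add: divide_simps distrib_left mult.commute)
      then have "z\<^sup>2 * (u / (1 + u)) \<le> z\<^sup>2 * (u0 / (1 + u0))" by (intro mult_left_mono) auto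
      then have "tilt x u \<le> 1 * exp (z\<^sup>2 * (u0 / (1 + u0)))"
        unfolding tilt_def z2 using powr_le_one_of_nonpos[OF u(1), of "-3/2"] by (intro mult_mono) auto
      then show "B * tilt x u \<le> ?h0" using B0 by simp
    next
      fix u assume u: "z \<le> u" "u \<le> z + 1"
      have u0': "0 < u" "ustar \<le> u" using u z1 W zW by linarith+
      have "exp (- 2 * (z + 1)) \<le> exp (- 2 * u)" using u by simp
      also have "\<dots> = exp u powr (-2)" by (simp add: powr_def)
      also have "\<dots> \<le> (1 + u) powr (-2)"
        using u0' exp_ge_add_one_self[of u] by (intro powr_mono2') auto
      also have "\<dots> \<le> (1 + u) powr (-3/2)" using u0' by (intro powr_mono) auto
      finally have 1: "exp (- 2 * (z + 1)) \<le> (1 + u) powr (-3/2)" .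
      \<comment> \<open>Placing the block at distance \<open>z\<close> makes the exponent of the
        tilt fall short of \<open>z\<^sup>2\<close> by at most \<open>z\<close>.\<close>
      have "z * z \<le> z * (1 + u)" using u z1 by (intro mult_left_mono) auto
      then have "z\<^sup>2 / (1 + u) \<le> z" using u0' by (simp add: divide_le_eq power2_eq_square)
      moreover have "z\<^sup>2 * (u / (1 + u)) = z\<^sup>2 - z\<^sup>2 / (1 + u)" using u0' by (simp add: field_simps)
      ultimately have 2: "z\<^sup>2 - z \<le> z\<^sup>2 * (u / (1 + u))" by linarith
      have "tau n p powr K * exp (- b' * (z + 1)) / C' \<le> tau n p powr K * exp (- b' * u) / C'"
        using u assms by (intro divide_right_mono mult_left_mono) auto
      also have "\<dots> \<le> f u" by (rule cond1_prior_ge[OF c1 \<open>0 < C'\<close> u0'(2)])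
      finally have 3: "tau n p powr K * exp (- b' * (z + 1)) / C' \<le> f u" .
      have "exp (- 2 * (z + 1)) * exp (z\<^sup>2 - z) \<le> tilt x u"
        unfolding tilt_def z2 using 1 2 by (intro mult_mono) auto
      then show "?h1 \<le> tilt x u * f u"
        using 3 \<open>0 < C'\<close> by (intro mult_mono tilt_nonneg) auto
    next
      show "0 \<le> ?h0" using B0 by simp
      \<comment> \<open>The additive margin \<open>W\<close> in the threshold becomes a margin
        linear in \<open>z\<close> between the squares.\<close>
      have "W * z \<le> (z - a) * (z + a)"
        using z z1 a W by (intro mult_mono) auto
      also have "\<dots> = z\<^sup>2 - a\<^sup>2" by (simp add: algebra_simps power2_eq_square)
      finally have Wz: "W2 * z \<le> z\<^sup>2 - a\<^sup>2"
        using W z1 mult_right_mono[of W2 W z] by linarith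
      then have "W2 * z / (1 + u0) \<le> (z\<^sup>2 - a\<^sup>2) / (1 + u0)"
        using \<open>0 < u0\<close> by (intro divide_right_mono) auto
      then have "(6 + 2 * b' + \<bar>ln (B * C')\<bar>) * z \<le> z\<^sup>2 / (1 + u0) - K * l"
        using \<open>0 < u0\<close> unfolding a W2_def by (simp add: diff_divide_distrib add.commute)
      moreover have "\<bar>ln (B * C')\<bar> * 1 \<le> \<bar>ln (B * C')\<bar> * z" "b' * 1 \<le> b' * z"
        by (rule mult_left_mono; use z1 \<open>0 < b'\<close> in simp)+
      ultimately have "ln (B * C') - z\<^sup>2 / (1 + u0) < - 2 * (z + 1) - z - K * l - b' * (z + 1)"
        using z1 by (simp add: algebra_simps)
      moreover have "z\<^sup>2 * (u0 / (1 + u0)) = z\<^sup>2 - z\<^sup>2 / (1 + u0)"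
        using \<open>0 < u0\<close> by (simp add: field_simps)
      ultimately have "ln (B * C') + z\<^sup>2 * (u0 / (1 + u0))
          < - 2 * (z + 1) + (z\<^sup>2 - z) + (- (K * l) + - b' * (z + 1))"
        by linarith
      then have "exp (ln (B * C') + z\<^sup>2 * (u0 / (1 + u0)))
          < exp (- 2 * (z + 1) + (z\<^sup>2 - z) + (- (K * l) + - b' * (z + 1)))"
        by (simp only: exp_less_cancel_iff)
      then have "B * C' * exp (z\<^sup>2 * (u0 / (1 + u0)))
          < exp (- 2 * (z + 1)) * exp (z\<^sup>2 - z) * (exp (- (K * l)) * exp (- b' * (z + 1)))"
        using B0 \<open>0 < C'\<close> by (simp only: exp_add) simp
      moreover have "tau n p powr K = exp (- (K * l))"
        using \<tau> by (simp add: powr_def l_def ln_div)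
      ultimately show "?h0 < ?h1"
        using \<open>0 < C'\<close> by (simp only: times_divide_eq_right less_divide_eq) (simp only: mult_ac if_True)
    qed
    then show "\<alpha> < mx f x" by (rule mx_gt_of_odds[OF f \<alpha> B(1)])
  qed
qed

section \<open>Risk of the multiple test\<close>

lemma gauss_model_prob_space: "prob_space (gauss_model n \<theta>)"
  unfolding gauss_model_def by (intro prob_space_PiM prob_space_normal_density) simp

lemma gauss_model_component:
  assumes "i < n" and [measurable]: "g \<in> borel_measurable borel"
  shows gauss_model_component_measurable: "(\<lambda>X. g (X i)) \<in> borel_measurable (gauss_model n \<theta>)"
    and gauss_model_component_integral:
      "(\<integral>X. g (X i) \<partial>gauss_model n \<theta>)
        = (\<integral>x. (g x :: real) \<partial>density lborel (normal_density (\<theta> i) 1))"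
proof -
  let ?N = "\<lambda>i. density lborel (normal_density (\<theta> i) 1)"
  have comp: "(\<lambda>X. X i) \<in> measurable (Pi\<^sub>M {..<n} ?N) (?N i)"
    using assms by (intro measurable_component_singleton) auto
  then have comp': "(\<lambda>X. X i) \<in> measurable (Pi\<^sub>M {..<n} ?N) borel"
    by (simp cong: measurable_cong_sets)
  show "(\<lambda>X. g (X i)) \<in> borel_measurable (gauss_model n \<theta>)"
    unfolding gauss_model_def by (rule measurable_compose[OF comp']) simp
  have "(\<integral>x. g x \<partial>?N i) = (\<integral>x. g x \<partial>distr (Pi\<^sub>M {..<n} ?N) (?N i) (\<lambda>X. X i))"
    using assms by (subst distr_PiM_component) (auto intro: prob_space_normal_density)
  also have "\<dots> = (\<integral>X. g (X i) \<partial>Pi\<^sub>M {..<n} ?N)"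
    by (rule integral_distr[OF comp]) simp
  finally show "(\<integral>X. g (X i) \<partial>gauss_model n \<theta>) = (\<integral>x. g x \<partial>?N i)"
    by (simp add: gauss_model_def)
qed

lemma xi_measurable: "is_prior_density f \<Longrightarrow> xi f \<alpha> \<in> borel_measurable borel"
  unfolding xi_def[abs_def] using mx_measurable[of f] by simp

lemma xi_bounds: "0 \<le> xi f \<alpha> x" "xi f \<alpha> x \<le> 1"
  by (simp_all add: xi_def)

lemma xi_component:
  assumes f: "is_prior_density f" and i: "i < n"
  shows xi_component_integrable: "integrable (gauss_model n \<theta>) (\<lambda>X. xi f \<alpha> (X i))"
    and xi_component_integral: "(\<integral>X. xi f \<alpha> (X i) \<partial>gauss_model n \<theta>)
      = measure (density lborel (normal_density (\<theta> i) 1)) {x. \<alpha> < mx f x}"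
    and xi_component_miss: "(\<integral>X. 1 - xi f \<alpha> (X i) \<partial>gauss_model n \<theta>)
      = measure (density lborel (normal_density (\<theta> i) 1)) {x. mx f x \<le> \<alpha>}"
proof -
  interpret prob_space "gauss_model n \<theta>" by (rule gauss_model_prob_space)
  note [measurable] = mx_measurable[OF f]
  show "integrable (gauss_model n \<theta>) (\<lambda>X. xi f \<alpha> (X i))"
    using xi_bounds
    by (intro integrable_const_bound[where B = 1] gauss_model_component_measurable[OF i xi_measurable[OF f]])
      (auto simp: abs_of_nonneg)
  have "(\<integral>x. xi f \<alpha> x \<partial>density lborel (normal_density (\<theta> i) 1))
    = (\<integral>x. indicator {x. \<alpha> < mx f x} x \<partial>density lborel (normal_density (\<theta> i) 1))"
    by (intro Bochner_Integration.integral_cong) (auto simp: xi_def)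
  then show "(\<integral>X. xi f \<alpha> (X i) \<partial>gauss_model n \<theta>)
      = measure (density lborel (normal_density (\<theta> i) 1)) {x. \<alpha> < mx f x}"
    by (simp add: gauss_model_component_integral[OF i xi_measurable[OF f]])
  have "(\<lambda>x. 1 - xi f \<alpha> x) \<in> borel_measurable borel" using xi_measurable[OF f] by simp
  note gauss_model_component_integral[OF i this]
  moreover have "(\<integral>x. 1 - xi f \<alpha> x \<partial>density lborel (normal_density (\<theta> i) 1))
    = (\<integral>x. indicator {x. mx f x \<le> \<alpha>} x \<partial>density lborel (normal_density (\<theta> i) 1))"
    by (intro Bochner_Integration.integral_cong) (auto simp: xi_def)
  ultimately show "(\<integral>X. 1 - xi f \<alpha> (X i) \<partial>gauss_model n \<theta>)
      = measure (density lborel (normal_density (\<theta> i) 1)) {x. mx f x \<le> \<alpha>}"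
    by simp
qed

text \<open>Affine in \<open>V\<close> and \<open>S\<close>: Markov's inequality for \<open>p - S\<close> on \<open>S < lam * p\<close>, and the tangent line
  at \<open>T * p\<close> of the concave map \<open>V \<mapsto> V / (V + lam * p)\<close> elsewhere.\<close>
lemma false_discovery_proportion_le:
  fixes V S p T lam :: real
  assumes V: "0 \<le> V" and S: "0 \<le> S" "S \<le> p" and p: "0 < p" and T: "0 < T" and lam: "0 < lam" "lam < 1"
  shows "V / max (V + S) 1 \<le> (p - S) / p / (1 - lam) + T / (T + lam) + lam / (T + lam)\<^sup>2 * (V / p - T)"
proof (cases "lam * p \<le> S")
  case True
  define v where "v = V / p"
  have v: "0 \<le> v" using V p by (simp add: v_def)
  have lp: "0 < lam * p" using lam p by simp
  have "V / max (V + S) 1 \<le> V / (V + lam * p)"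
    using V True lp by (intro divide_left_mono mult_pos_pos) auto
  also have "\<dots> = v / (v + lam)" using V p lam lp by (simp add: v_def divide_simps)
  \<comment> \<open>Tangent line at \<open>T\<close> with its exact remainder, whose sign expresses
    the concavity.\<close>
  also have "\<dots> = T / (T + lam) + lam / (T + lam)\<^sup>2 * (v - T) - lam * (v - T)\<^sup>2 / ((T + lam)\<^sup>2 * (v + lam))"
  proof -
    have "T + lam \<noteq> 0" "v + lam \<noteq> 0" using T lam v by linarith+
    then show ?thesis by (simp add: divide_simps) algebra
  qed
  also have "\<dots> \<le> T / (T + lam) + lam / (T + lam)\<^sup>2 * (v - T)"
    using lam v T by simp
  finally have "V / max (V + S) 1 \<le> T / (T + lam) + lam / (T + lam)\<^sup>2 * (V / p - T)"
    by (simp add: v_def)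
  moreover have "0 \<le> (p - S) / p / (1 - lam)" using S p lam by simp
  ultimately show ?thesis by linarith
next
  case False
  have "V / max (V + S) 1 \<le> 1" using V S by (simp add: divide_le_eq le_max_iff_disj)
  also have "1 \<le> (p - S) / p / (1 - lam)"
    using False p lam by (simp add: le_divide_eq algebra_simps)
  also have "\<dots> \<le> (p - S) / p / (1 - lam) + (T / (T + lam) + lam / (T + lam)\<^sup>2 * (V / p - T))"
  proof -
    have "T / (T + lam) + lam / (T + lam)\<^sup>2 * (V / p - T) = (T\<^sup>2 + lam * (V / p)) / (T + lam)\<^sup>2"
      using T lam by (simp add: divide_simps add_pos_pos) (simp add: algebra_simps power2_eq_square)
    also have "0 \<le> \<dots>" using T lam V p by simp
    finally show ?thesis by simp
  qed
  finally show ?thesis by simp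
qed

text \<open>The bound on the false discovery proportion is affine, so taking expectations leaves the
  means of \<open>V\<close> and \<open>S\<close>. The mean of \<open>V\<close> is at most
  \<open>T * p\<close>, which makes the tangent term nonpositive; the mean of \<open>p - S\<close>
  gives FNR again, with the factor \<open>1 / (1 - lam)\<close>.\<close>

lemma Rsup_le:
  fixes T \<delta> lam :: real
  assumes f: "is_prior_density f" and np: "1 \<le> p" "p \<le> n"
    and card: "card {i. i < n \<and> \<theta> i \<noteq> 0} = p"
    and T: "0 < T" and lam: "0 < lam" "lam < 1"
    and t1: "measure (density lborel (normal_density 0 1)) {x. \<alpha> < mx f x} \<le> T * tau n p"
    and t2: "\<And>i. i < n \<Longrightarrow> \<theta> i \<noteq> 0 \<Longrightarrow>
      measure (density lborel (normal_density (\<theta> i) 1)) {x. mx f x \<le> \<alpha>} \<le> \<delta>"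
  shows "Rsup f \<alpha> n p \<theta> \<le> 1 / (1 + lam / T) + \<delta> * (1 + 1 / (1 - lam))"
proof -
  interpret prob_space "gauss_model n \<theta>" by (rule gauss_model_prob_space)
  let ?M = "gauss_model n \<theta>"
  let ?S0 = "{i. i < n \<and> \<theta> i = 0}" and ?S1 = "{i. i < n \<and> \<theta> i \<noteq> 0}"
  define V where "V X = (\<Sum>i\<in>?S0. xi f \<alpha> (X i))" for X
  define S where "S X = (\<Sum>i\<in>?S1. xi f \<alpha> (X i))" for X
  have p: "0 < real p" and n: "0 < real n" using np by simp_all
  have iV: "integrable ?M V" unfolding V_def
    by (intro Bochner_Integration.integrable_sum xi_component_integrable[OF f]) auto
  have iS: "integrable ?M S" unfolding S_def
    by (intro Bochner_Integration.integrable_sum xi_component_integrable[OF f]) auto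
  have V0: "0 \<le> V X" for X unfolding V_def by (intro sum_nonneg xi_bounds)
  have S0: "0 \<le> S X" for X unfolding S_def by (intro sum_nonneg xi_bounds)
  have Sp: "S X \<le> real p" for X
    using sum_bounded_above[of ?S1 "\<lambda>i. xi f \<alpha> (X i)" 1] xi_bounds card by (simp add: S_def)
  have VS: "(\<Sum>i<n. xi f \<alpha> (X i)) = V X + S X" for X
  proof -
    have "{..<n} = ?S0 \<union> ?S1" by auto
    then show ?thesis unfolding V_def S_def
      by (simp only:) (rule sum.union_disjoint, auto)
  qed
  have miss: "(\<Sum>i\<in>?S1. 1 - xi f \<alpha> (X i)) = real p - S X" for X
    using card by (simp add: S_def sum_subtractf)
  have EV: "(\<integral>X. V X \<partial>?M) \<le> T * real p"
  proof -
    have "(\<integral>X. V X \<partial>?M) = (\<Sum>i\<in>?S0. (\<integral>X. xi f \<alpha> (X i) \<partial>?M))"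
      unfolding V_def by (intro Bochner_Integration.integral_sum xi_component_integrable[OF f]) auto
    also have "\<dots> \<le> (\<Sum>i\<in>?S0. T * tau n p)"
    proof (rule sum_mono)
      fix i assume "i \<in> ?S0"
      then show "(\<integral>X. xi f \<alpha> (X i) \<partial>?M) \<le> T * tau n p"
        using t1 xi_component_integral[OF f, of i n \<theta> \<alpha>] by simp
    qed
    also have "\<dots> = real (card ?S0) * (T * tau n p)" by simp
    also have "\<dots> \<le> real n * (T * tau n p)"
      using card_mono[of "{..<n}" ?S0] T by (intro mult_right_mono) (auto simp: tau_def)
    also have "\<dots> = T * real p" using n by (simp add: tau_def)
    finally show ?thesis .
  qed
  have FNR_eq: "FNR f \<alpha> n p \<theta> = (\<integral>X. (real p - S X) / real p \<partial>?M)"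
    unfolding FNR_def miss ..
  have "(\<integral>X. real p - S X \<partial>?M) = (\<Sum>i\<in>?S1. (\<integral>X. 1 - xi f \<alpha> (X i) \<partial>?M))"
    unfolding miss[symmetric]
    by (intro Bochner_Integration.integral_sum Bochner_Integration.integrable_diff
      xi_component_integrable[OF f]) auto
  also have "\<dots> \<le> (\<Sum>i\<in>?S1. \<delta>)"
  proof (rule sum_mono)
    fix i assume "i \<in> ?S1"
    then show "(\<integral>X. 1 - xi f \<alpha> (X i) \<partial>?M) \<le> \<delta>"
      using t2[of i] xi_component_miss[OF f, of i n \<theta> \<alpha>] by simp
  qed
  also have "\<dots> = real p * \<delta>" using card by simp
  finally have FNR: "FNR f \<alpha> n p \<theta> \<le> \<delta>"
    unfolding FNR_eq using p by (simp add: divide_le_eq mult.commute)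
  have "FDR f \<alpha> n \<theta> = (\<integral>X. V X / max (V X + S X) 1 \<partial>?M)"
    unfolding FDR_def VS V_def[symmetric] ..
  also have "\<dots> \<le> (\<integral>X. (real p - S X) / real p / (1 - lam) + T / (T + lam)
      + lam / (T + lam)\<^sup>2 * (V X / real p - T) \<partial>?M)"
  proof (rule integral_mono)
    show "integrable ?M (\<lambda>X. V X / max (V X + S X) 1)"
    proof (rule integrable_const_bound[where B = 1])
      show "(\<lambda>X. V X / max (V X + S X) 1) \<in> borel_measurable ?M"
        using iV iS by (intro borel_measurable_divide borel_measurable_max borel_measurable_add) auto
      have "\<bar>V X / max (V X + S X) 1\<bar> \<le> 1" for X
        using V0[of X] S0[of X] by (simp add: abs_of_nonneg divide_le_eq le_max_iff_disj)
      then show "AE X in ?M. norm (V X / max (V X + S X) 1) \<le> 1" by simp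
    qed
    show "integrable ?M (\<lambda>X. (real p - S X) / real p / (1 - lam) + T / (T + lam)
      + lam / (T + lam)\<^sup>2 * (V X / real p - T))"
      using iV iS by (intro Bochner_Integration.integrable_add Bochner_Integration.integrable_diff
        integrable_mult_right integrable_divide integrable_const)
    show "V X / max (V X + S X) 1 \<le> (real p - S X) / real p / (1 - lam) + T / (T + lam)
      + lam / (T + lam)\<^sup>2 * (V X / real p - T)" for X
      by (rule false_discovery_proportion_le[OF V0 S0 Sp p T lam])
  qed
  also have "\<dots> = FNR f \<alpha> n p \<theta> / (1 - lam) + T / (T + lam)
      + lam / (T + lam)\<^sup>2 * ((\<integral>X. V X \<partial>?M) / real p - T)"
    unfolding FNR_eq using iV iS by (simp add: prob_space)
  also have "\<dots> \<le> FNR f \<alpha> n p \<theta> / (1 - lam) + T / (T + lam)"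
    using EV p T lam by (simp add: mult_le_0_iff divide_le_eq)
  also have "T / (T + lam) = 1 / (1 + lam / T)" using T lam by (simp add: field_simps)
  finally have "Rsup f \<alpha> n p \<theta> \<le> FNR f \<alpha> n p \<theta> / (1 - lam) + 1 / (1 + lam / T) + FNR f \<alpha> n p \<theta>"
    by (simp add: Rsup_def)
  also have "\<dots> \<le> \<delta> / (1 - lam) + 1 / (1 + lam / T) + \<delta>"
    using FNR divide_right_mono[OF FNR, of "1 - lam"] lam by linarith
  finally show ?thesis by (simp add: algebra_simps)
qed

text \<open>A miss forces \<open>\<bar>x\<bar> < m\<close>, so an observation centred at \<mu> must
  deviate from it by more than \<open>t\<close>.\<close>

lemma type2_error_le:
  assumes "0 < t" and large: "\<And>x. m \<le> \<bar>x\<bar> \<Longrightarrow> \<alpha> < mx f x" and \<mu>: "m + t \<le> \<bar>\<mu>\<bar>"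
  shows "measure (density lborel (normal_density \<mu> 1)) {x. mx f x \<le> \<alpha>} \<le> 2 * (std_normal_density t / t)"
proof -
  interpret N: prob_space "density lborel (normal_density \<mu> 1)"
    by (rule prob_space_normal_density) simp
  have "{x. mx f x \<le> \<alpha>} \<subseteq> {x. t \<le> \<bar>x - \<mu>\<bar>}"
  proof clarsimp
    fix x assume "mx f x \<le> \<alpha>"
    then have "\<bar>x\<bar> < m" using large[of x] by (meson leD leI)
    then show "t \<le> \<bar>x - \<mu>\<bar>" using \<mu> by linarith
  qed
  then have "measure (density lborel (normal_density \<mu> 1)) {x. mx f x \<le> \<alpha>}
    \<le> measure (density lborel (normal_density \<mu> 1)) {x. t \<le> \<bar>x - \<mu>\<bar>}"
    by (rule N.finite_measure_mono) auto
  also have "\<dots> \<le> 2 * (std_normal_density t / t)" by (rule normal_tail[OF \<open>0 < t\<close>])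
  finally show ?thesis .
qed

text \<open>Required to bound a supremum of reals from above. Taking \<open>max \<rho> 1\<close>
  keeps the first \<open>p\<close> coordinates nonzero even when \<rho> is not positive.\<close>

lemma param_set_nonempty:
  assumes "p \<le> n" shows "param_set n p \<rho> \<noteq> {}"
proof -
  let ?\<theta> = "\<lambda>i. if i < p then max \<rho> 1 else 0 :: real"
  have "{i. i < n \<and> ?\<theta> i \<noteq> 0} = {..<p}" using assms by auto
  then have "?\<theta> \<in> param_set n p \<rho>"
    using assms by (auto simp: param_set_def)
  then show ?thesis by blast
qed

section \<open>Asymptotics in the sparsity and the final bound\<close>

lemma Phi_nonneg: "0 \<le> Phi x"
  unfolding Phi_def set_lebesgue_integral_def by (intro integral_nonneg_AE AE_I2) simp

lemma nu_eq: "nu n p = sqrt (ln (1 / tau n p))"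
  by (simp add: nu_def tau_def)

lemma s_n_eq: "1 \<le> nu n p \<Longrightarrow> s_n n p = tau n p * ln (1 / tau n p)"
  by (auto simp: s_n_def nu_eq)

text \<open>Everything is eventually a function of \<open>tau n (p n)\<close>, which tends to 0 from
  the right. The critical term \<open>exp ((nu n (p n))\<^sup>2 / 2) * s_n n (p n)\<close> is the
  square root of tau times \<open>ln (1 / tau)\<close>.\<close>

lemma type1_asymptotics:
  fixes p :: "nat \<Rightarrow> nat" and C a :: real
  assumes p: "\<forall>n. 1 \<le> p n" "(\<lambda>n. real (p n) / real n) \<longlonglongrightarrow> 0" and a: "0 < a"
  shows "\<forall>\<^sub>F n in sequentially. 1 \<le> p n \<and> p n \<le> n \<and> 0 < tau n (p n) \<and> tau n (p n) \<le> 1 \<and>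
      1 \<le> nu n (p n) \<and> 0 < s_n n (p n) \<and> s_n n (p n) \<le> 1"
    and "0 < C \<Longrightarrow> \<forall>\<^sub>F n in sequentially. a \<le> C * nu n (p n)"
    and "\<forall>\<^sub>F n in sequentially. s_n n (p n) * exp (s_n n (p n) * (nu n (p n))\<^sup>2)
      + exp ((nu n (p n))\<^sup>2 / 2) * (C * s_n n (p n)) \<le> a"
proof -
  let ?\<tau> = "\<lambda>n. tau n (p n)"
  \<comment> \<open>At \<open>n = 0\<close> the quotient is 0 by convention, so positivity holds
    only for \<open>n > 0\<close>.\<close>
  have pos: "\<forall>\<^sub>F n in sequentially. 0 < ?\<tau> n"
    using eventually_gt_at_top[of 0]
    by eventually_elim (use p(1) in \<open>auto simp: tau_def Suc_le_eq\<close>)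
  have "?\<tau> \<longlonglongrightarrow> 0" using p(2) by (simp add: tau_def)
  then have lim: "filterlim ?\<tau> (at_right 0) sequentially"
    using pos by (intro tendsto_imp_filterlim_at_right) auto
  note ev = eventually_compose_filterlim[OF _ lim]
  have e1: "\<forall>\<^sub>F n in sequentially. 1 \<le> sqrt (ln (1 / ?\<tau> n))"
    by (rule ev) real_asymp
  have e2: "\<forall>\<^sub>F n in sequentially. ?\<tau> n < 1"
    by (rule ev) real_asymp
  have e3: "\<forall>\<^sub>F n in sequentially. ?\<tau> n * ln (1 / ?\<tau> n) < 1"
    by (rule ev) real_asymp
  show "\<forall>\<^sub>F n in sequentially. 1 \<le> p n \<and> p n \<le> n \<and> 0 < ?\<tau> n \<and> ?\<tau> n \<le> 1 \<and>
      1 \<le> nu n (p n) \<and> 0 < s_n n (p n) \<and> s_n n (p n) \<le> 1"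
    using e1 e2 e3 pos eventually_gt_at_top[of 0]
  proof eventually_elim
    case (elim n)
    have nu: "1 \<le> nu n (p n)" using elim by (simp add: nu_eq)
    then have "0 < s_n n (p n)" using elim by (simp add: s_n_def)
    moreover have "p n \<le> n" using elim by (simp add: tau_def divide_less_eq)
    ultimately show ?case using elim nu p(1) s_n_eq[OF nu] by simp
  qed
  show "\<forall>\<^sub>F n in sequentially. a \<le> C * nu n (p n)" if "0 < C"
  proof -
    have "filterlim (\<lambda>t. C * sqrt (ln (1 / t))) at_top (at_right 0)" using that by real_asymp
    then have "\<forall>\<^sub>F t in at_right 0. a \<le> C * sqrt (ln (1 / t))" by (simp add: filterlim_at_top)
    from ev[OF this] show ?thesis by (simp add: nu_eq)
  qed
  have "((\<lambda>t. t * ln (1 / t) * exp (t * ln (1 / t) * ln (1 / t))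
      + exp (ln (1 / t) / 2) * (C * (t * ln (1 / t)))) \<longlongrightarrow> 0) (at_right 0)"
    by real_asymp
  then have "\<forall>\<^sub>F t in at_right 0. t * ln (1 / t) * exp (t * ln (1 / t) * ln (1 / t))
      + exp (ln (1 / t) / 2) * (C * (t * ln (1 / t))) < a"
    using a by (rule order_tendstoD)
  from ev[OF this] e1
  show "\<forall>\<^sub>F n in sequentially. s_n n (p n) * exp (s_n n (p n) * (nu n (p n))\<^sup>2)
      + exp ((nu n (p n))\<^sup>2 / 2) * (C * s_n n (p n)) \<le> a"
  proof eventually_elim
    case (elim n)
    have nu: "1 \<le> nu n (p n)" using elim by (simp add: nu_eq)
    have "(nu n (p n))\<^sup>2 = ln (1 / ?\<tau> n)" using elim by (auto simp: nu_eq)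
    then show ?case using elim(1) by (simp only: s_n_eq[OF nu])
  qed
qed

theorem theorem2:
  fixes \<alpha> ustar u0 R b b' C' :: real
  assumes "0 < \<alpha>" "\<alpha> < 1"
    and "R > 0" "u0 > 0" "b \<ge> 0" "b' > 0" "C' > 0" "ustar \<ge> 1"
  shows "\<exists>C1::real. \<forall>(\<pi>::nat \<Rightarrow> real \<Rightarrow> real) (p::nat \<Rightarrow> nat) (c::real) (C::real) (K::real).
    ((\<forall>n. 1 \<le> p n) \<and> ((\<lambda>n. real (p n) / real n) \<longlonglongrightarrow> 0) \<and> K \<ge> 0 \<and> c > 0 \<and>
     (\<forall>\<^sub>F n in sequentially.
        is_prior_density (\<pi> n) \<and> cond1 b R u0 C' b' K ustar (\<pi> n) n (p n)
        \<and> cond2 c (\<pi> n) \<and> cond3 C (\<pi> n) n (p n)))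
    \<longrightarrow> (\<forall>(v::nat \<Rightarrow> real) (lam::real). filterlim v at_top sequentially \<and> 0 < lam \<and> lam < 1 \<longrightarrow>
          (\<exists>\<epsilon>::nat \<Rightarrow> real. \<epsilon> \<longlonglongrightarrow> 0 \<and>
             (\<forall>\<^sub>F n in sequentially.
                (SUP \<theta>\<in>param_set n (p n)
                     (C1 + sqrt (2 * K * (u0 + 1) * ln (real n / real (p n))) + v n).
                   Rsup (\<pi> n) \<alpha> n (p n) \<theta>)
                \<le> (1 / (1 + lam * \<alpha> * c / (8 * C * sqrt pi)) + Phi (- v n)) * (1 + \<epsilon> n))))"
proof -
  obtain W where W: "0 < W" and large: "\<And>f n p K x. is_prior_density f \<Longrightarrow>
      cond1 b R u0 C' b' K ustar f n p \<Longrightarrow> 0 < tau n p \<Longrightarrow> tau n p \<le> 1 \<Longrightarrow> 0 \<le> K \<Longrightarrow>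
      sqrt (K * (u0 + 1) * ln (1 / tau n p)) + W \<le> \<bar>x\<bar> / sqrt 2 \<Longrightarrow> \<alpha> < mx f x"
    using mx_gt_if_large[OF assms] by blast
  show ?thesis
  proof (intro exI[of _ 0] allI impI, elim conjE)
    fix \<pi> :: "nat \<Rightarrow> real \<Rightarrow> real" and p :: "nat \<Rightarrow> nat" and c C K :: real and v :: "nat \<Rightarrow> real" and lam :: real
    assume p: "\<forall>n. 1 \<le> p n" "(\<lambda>n. real (p n) / real n) \<longlonglongrightarrow> 0" and K: "0 \<le> K" and c: "0 < c"
      and conds: "\<forall>\<^sub>F n in sequentially.
        is_prior_density (\<pi> n) \<and> cond1 b R u0 C' b' K ustar (\<pi> n) n (p n)
        \<and> cond2 c (\<pi> n) \<and> cond3 C (\<pi> n) n (p n)"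
      and v: "filterlim v at_top sequentially" and lam: "0 < lam" "lam < 1"
    define a where "a = \<alpha> * c / (2 * sqrt 2)"
    have a: "0 < a" using assms c by (simp add: a_def)
    note as = type1_asymptotics[OF p a]
    \<comment> \<open>\<open>C\<close> does not depend on \<open>n\<close>, so a single index at
      which all conditions hold decides its sign.\<close>
    have "\<forall>\<^sub>F n in sequentially. 0 < C"
      using conds as(1) by eventually_elim (use assms in \<open>auto intro: cond3_const_pos\<close>)
    then have C: "0 < C" by simp
    define T where "T = 8 * C * sqrt pi / (\<alpha> * c)"
    have T: "0 < T" using C c assms by (simp add: T_def)
    define A where "A = 1 / (1 + lam / T)"
    have A: "0 < A" using T lam by (simp add: A_def add_pos_pos)
    have A_eq: "A = 1 / (1 + lam * \<alpha> * c / (8 * C * sqrt pi))"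
      by (simp add: A_def T_def mult.assoc)
    \<comment> \<open>Gaussian tail bound at deviation \<open>t / 2\<close>, since only half of
      \<open>v n\<close> is spent on the noise.\<close>
    define \<delta> where "\<delta> t = 2 * (std_normal_density (t / 2) / (t / 2))" for t
    have "(\<delta> \<longlongrightarrow> 0) at_top"
      unfolding \<delta>_def[abs_def] std_normal_density_def by real_asymp
    then have \<delta>: "(\<lambda>n. \<delta> (v n)) \<longlonglongrightarrow> 0" using v by (rule filterlim_compose)
    \<comment> \<open>Dividing by the fixed positive \<open>A\<close> turns the additive error into
      a multiplicative one.\<close>
    let ?\<epsilon> = "\<lambda>n. \<delta> (v n) * (1 + 1 / (1 - lam)) / A"
    have "?\<epsilon> \<longlonglongrightarrow> 0 * (1 + 1 / (1 - lam)) / A"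
      using A by (intro tendsto_intros \<delta>) auto
    then have "?\<epsilon> \<longlonglongrightarrow> 0" by simp
    moreover have "\<forall>\<^sub>F n in sequentially.
        (SUP \<theta>\<in>param_set n (p n) (0 + sqrt (2 * K * (u0 + 1) * ln (real n / real (p n))) + v n).
           Rsup (\<pi> n) \<alpha> n (p n) \<theta>)
        \<le> (1 / (1 + lam * \<alpha> * c / (8 * C * sqrt pi)) + Phi (- v n)) * (1 + ?\<epsilon> n)"
      using conds as(1) as(2)[OF C] as(3)[of C] filterlim_at_top_dense[THEN iffD1, OF v, rule_format, of "2 * sqrt 2 * W"]
    proof eventually_elim
      case (elim n)
      let ?f = "\<pi> n" and ?p = "p n"
      let ?\<rho> = "0 + sqrt (2 * K * (u0 + 1) * ln (real n / real (p n))) + v n"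
      have f: "is_prior_density ?f" and np: "1 \<le> ?p" "?p \<le> n" using elim by auto
      have vn: "2 * sqrt 2 * W < v n" "0 < v n" using elim W by (auto intro: less_trans[rotated])
      have t1: "measure (density lborel (normal_density 0 1)) {x. \<alpha> < mx ?f x} \<le> T * tau n ?p"
        unfolding T_def using elim assms c C unfolding a_def
        by (intro type1_error_le) auto
      have l: "ln (1 / tau n ?p) = ln (real n / real ?p)" by (simp add: tau_def)
      let ?m = "sqrt 2 * (sqrt (K * (u0 + 1) * ln (1 / tau n ?p)) + W)"
      have m: "\<alpha> < mx ?f x" if "?m \<le> \<bar>x\<bar>" for x
        using that elim K by (intro large[of ?f K n ?p]) (auto simp: le_divide_eq mult.commute)
      \<comment> \<open>One half of \<open>v n\<close> covers the constant \<open>sqrt 2 * W\<close>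
        inside \<open>?m\<close>, which is why \<open>C1 = 0\<close> suffices; the other half is
        left as the deviation.\<close>
      have \<rho>: "?m + v n / 2 \<le> ?\<rho>"
      proof -
        have "sqrt (2 * K * (u0 + 1) * ln (real n / real ?p)) = sqrt 2 * sqrt (K * (u0 + 1) * ln (1 / tau n ?p))"
          unfolding l real_sqrt_mult[symmetric] by (simp add: mult.assoc)
        then show ?thesis using vn by (simp add: algebra_simps)
      qed
      have A\<delta>: "Rsup ?f \<alpha> n ?p \<theta> \<le> A + \<delta> (v n) * (1 + 1 / (1 - lam))" if \<theta>: "\<theta> \<in> param_set n ?p ?\<rho>" for \<theta>
        unfolding A_def
      proof (rule Rsup_le[OF f np _ T lam t1])
        show "card {i. i < n \<and> \<theta> i \<noteq> 0} = ?p" using \<theta> by (simp add: param_set_def)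
        fix i assume i: "i < n" "\<theta> i \<noteq> 0"
        then have "?\<rho> \<le> \<bar>\<theta> i\<bar>" using \<theta> by (simp add: param_set_def)
        with \<rho> have "?m + v n / 2 \<le> \<bar>\<theta> i\<bar>" by linarith
        then show "measure (density lborel (normal_density (\<theta> i) 1)) {x. mx ?f x \<le> \<alpha>} \<le> \<delta> (v n)"
          unfolding \<delta>_def using vn by (intro type2_error_le[where m = ?m] m) auto
      qed
      have \<delta>0: "0 \<le> \<delta> (v n) * (1 + 1 / (1 - lam)) / A" using vn lam A by (simp add: \<delta>_def)
      have "(SUP \<theta>\<in>param_set n ?p ?\<rho>. Rsup ?f \<alpha> n ?p \<theta>) \<le> A + \<delta> (v n) * (1 + 1 / (1 - lam))"
        using A\<delta> by (intro cSUP_least param_set_nonempty np)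
      also have "\<dots> = A * (1 + ?\<epsilon> n)" using A by (simp add: field_simps)
      also have "\<dots> \<le> (A + Phi (- v n)) * (1 + ?\<epsilon> n)"
        using \<delta>0 Phi_nonneg[of "- v n"] by (intro mult_right_mono) auto
      finally show ?case unfolding A_eq .
    qed
    ultimately show "\<exists>\<epsilon>. \<epsilon> \<longlonglongrightarrow> 0 \<and> (\<forall>\<^sub>F n in sequentially.
        (SUP \<theta>\<in>param_set n (p n) (0 + sqrt (2 * K * (u0 + 1) * ln (real n / real (p n))) + v n).
           Rsup (\<pi> n) \<alpha> n (p n) \<theta>)
        \<le> (1 / (1 + lam * \<alpha> * c / (8 * C * sqrt pi)) + Phi (- v n)) * (1 + \<epsilon> n))"
      by blast
  qed
qed

end
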